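(* Let $S=K[x_1,\ldots,x_d]$ be a polynomial ring over a field $K$, and $J\subseteq S$ an ideal. Let $T=K[x_1,\ldots,x_d,\tilde x_1,\ldots,\tilde x_d]\supseteq S$ and $\Delta=(x_1-\tilde x_1,\dots,x_d-\tilde x_d)\subseteq T$, and let $\tilde J\subseteq T$ be the ideal of $T$ generated by the elements of $J$ written in the variables $\tilde x_i$ (in place of $x_i$). Then for every $n\ge1$ $$J^{\langle n\rangle_K}=\big(\tilde J+\Delta^n\big)\cap S .$$ As a consequence, if $K$ is perfect and $J$ is radical, then $J^{(n)}=\big(\tilde J+\Delta^n\big)\cap S$.
   Context: Differential operators: $D^0_{S|K}=\operatorname{Hom}_S(S,S)$ and $D^n_{S|K}=\{\delta\in\operatorname{Hom}_K(S,S) : [\delta,g]\in D^{n-1}_{S|K}\ \forall g\in S\}$. Differential powers: $J^{\langle n\rangle_K}=\{f\in S : \delta(f)\in J \text{ for all }\delta\in D^{n-1}_{S|K}\}$. For a radical ideal $J$, the symbolic power is $J^{(n)}=\bigcap_{\mathfrak p}(J^nS_{\mathfrak p}\cap S)$, the intersection over the minimal primes $\mathfrak p$ of $J$. *)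

theory Defs
  imports Complex_Main "HOL-Library.Poly_Mapping" "HOL-Computational_Algebra.Fraction_Field"
begin

section \<open>Ideals of a commutative ring\<close>

text \<open>The ideals of a commutative ring are its submodules as a module over itself.\<close>

lemma module_mult: "module ((*) :: 'a::comm_ring_1 \<Rightarrow> 'a \<Rightarrow> 'a)"
  by unfold_locales (simp_all add: algebra_simps)

definition is_ideal :: "'a::comm_ring_1 set \<Rightarrow> bool" where
  "is_ideal I \<longleftrightarrow> module.subspace (*) I"

definition ideal_gen :: "'a::comm_ring_1 set \<Rightarrow> 'a set" where
  "ideal_gen B = module.span (*) B"

definition ideal_sum :: "'a::comm_ring_1 set \<Rightarrow> 'a set \<Rightarrow> 'a set" where
  "ideal_sum I J = {a + b | a b. a \<in> I \<and> b \<in> J}"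

definition ideal_prod :: "'a::comm_ring_1 set \<Rightarrow> 'a set \<Rightarrow> 'a set" where
  "ideal_prod I J = ideal_gen {a * b | a b. a \<in> I \<and> b \<in> J}"

primrec ideal_power :: "'a::comm_ring_1 set \<Rightarrow> nat \<Rightarrow> 'a set" where
  "ideal_power I 0 = UNIV"
| "ideal_power I (Suc n) = ideal_prod I (ideal_power I n)"

definition radical :: "'a::comm_ring_1 set \<Rightarrow> 'a set" where
  "radical I = {f. \<exists>n. f ^ n \<in> I}"

definition radical_ideal :: "'a::comm_ring_1 set \<Rightarrow> bool" where
  "radical_ideal I \<longleftrightarrow> is_ideal I \<and> radical I = I"

definition prime_ideal :: "'a::comm_ring_1 set \<Rightarrow> bool" where
  "prime_ideal P \<longleftrightarrow>
     is_ideal P \<and> P \<noteq> UNIV \<and> (\<forall>a b. a * b \<in> P \<longrightarrow> a \<in> P \<or> b \<in> P)"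

definition minimal_primes :: "'a::comm_ring_1 set \<Rightarrow> 'a set set" where
  "minimal_primes I =
     {P. prime_ideal P \<and> I \<subseteq> P \<and> (\<forall>Q. prime_ideal Q \<and> I \<subseteq> Q \<and> Q \<subseteq> P \<longrightarrow> Q = P)}"

section \<open>Localization at a prime and symbolic powers\<close>

text \<open>
  All rings to be localized are domains, so the localization of \<open>S\<close> at a prime \<open>P\<close> is taken as a
  subring of the fraction field of \<open>S\<close>, and \<open>S\<close> is mapped into it by \<open>f \<mapsto> f / 1\<close>.
\<close>

definition localization :: "'a::idom set \<Rightarrow> 'a fract set" where
  "localization P = {Fract a s | a s. s \<notin> P}"

text \<open>The ideal \<open>I S\<^sub>P\<close> of \<open>S\<^sub>P\<close> generated by the image of \<open>I\<close>.\<close>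

definition extension :: "'a::idom set \<Rightarrow> 'a set \<Rightarrow> 'a fract set" where
  "extension P I =
     {\<Sum>a\<in>A. r a * Fract a 1 | A r. finite A \<and> A \<subseteq> I \<and> r ` A \<subseteq> localization P}"

definition symbolic_power :: "'a::idom set \<Rightarrow> nat \<Rightarrow> 'a set" where
  "symbolic_power J n =
     (\<Inter>P\<in>minimal_primes J. (\<lambda>f. Fract f 1) -` extension P (ideal_power J n))"

section \<open>Differential operators and differential powers\<close>

text \<open>
  The \<open>K\<close>-algebra structure on \<open>S\<close> is given by the scalar multiplication \<open>scale\<close>, so that
  \<open>module_hom scale scale\<close> are the \<open>K\<close>-linear endomorphisms and \<open>module_hom (*) (*)\<close> the
  \<open>S\<close>-linear ones.
\<close>

primrec diff_ops ::
    "('k::comm_ring_1 \<Rightarrow> 's \<Rightarrow> 's) \<Rightarrow> nat \<Rightarrow> ('s::comm_ring_1 \<Rightarrow> 's) set" where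
  "diff_ops scale 0 = {\<delta>. module_hom (*) (*) \<delta>}"
| "diff_ops scale (Suc n) =
     {\<delta>. module_hom scale scale \<delta> \<and> (\<forall>g. (\<lambda>f. \<delta> (g * f) - g * \<delta> f) \<in> diff_ops scale n)}"

text \<open>Meaningful for \<open>n \<ge> 1\<close> only, because of the truncated subtraction.\<close>

definition differential_power ::
    "('k::comm_ring_1 \<Rightarrow> 's \<Rightarrow> 's) \<Rightarrow> 's::comm_ring_1 set \<Rightarrow> nat \<Rightarrow> 's set" where
  "differential_power scale J n = {f. \<forall>\<delta>\<in>diff_ops scale (n - 1). \<delta> f \<in> J}"

section \<open>Polynomial rings\<close>

text \<open>
  Polynomials with variables indexed by \<open>'v\<close> and coefficients in \<open>'k\<close>, with the convolution product
  of \<^theory>\<open>HOL-Library.Poly_Mapping\<close>.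
\<close>

type_synonym ('v, 'k) mpoly = "('v \<Rightarrow>\<^sub>0 nat) \<Rightarrow>\<^sub>0 'k"

definition Const :: "'k \<Rightarrow> ('v, 'k::comm_ring_1) mpoly" where
  "Const c = Poly_Mapping.single 0 c"

definition Var :: "'v \<Rightarrow> ('v, 'k::comm_ring_1) mpoly" where
  "Var i = Poly_Mapping.single (Poly_Mapping.single i 1) 1"

definition mscale :: "'k \<Rightarrow> ('v, 'k::comm_ring_1) mpoly \<Rightarrow> ('v, 'k) mpoly" where
  "mscale c p = Const c * p"

lemma module_mscale: "module (mscale :: 'k \<Rightarrow> ('v, 'k::comm_ring_1) mpoly \<Rightarrow> _)"
  by unfold_locales
    (simp_all add: mscale_def Const_def algebra_simps mult_single single_add
      flip: mult.assoc)

text \<open>The substitution \<open>x\<^sub>i \<mapsto> x\<^bsub>\<phi> i\<^esub>\<close>.\<close>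

definition rename_vars :: "('v \<Rightarrow> 'w) \<Rightarrow> ('v, 'k) mpoly \<Rightarrow> ('w, 'k::comm_ring_1) mpoly" where
  "rename_vars \<phi> p =
     (\<Sum>m\<in>Poly_Mapping.keys p. Const (Poly_Mapping.lookup p m) *
        (\<Prod>i\<in>Poly_Mapping.keys m. Var (\<phi> i) ^ Poly_Mapping.lookup m i))"

text \<open>
  For \<open>S = K[x\<^sub>1,\<dots>,x\<^sub>d]\<close> with variables indexed by \<open>'n\<close>, the ring \<open>T\<close> has variables indexed by
  \<open>'n + 'n\<close>: \<open>Inl i\<close> is the index of \<open>x\<^sub>i\<close> and \<open>Inr i\<close> that of the second variable belonging to
  \<open>i\<close>. The inclusion of \<open>S\<close> in \<open>T\<close> is \<open>incl_S\<close>.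
\<close>

definition incl_S :: "('n, 'k) mpoly \<Rightarrow> ('n + 'n, 'k::comm_ring_1) mpoly" where
  "incl_S = rename_vars Inl"

definition Delta :: "('n + 'n, 'k::comm_ring_1) mpoly set" where
  "Delta = ideal_gen {Var (Inl i) - Var (Inr i) | i. True}"

definition tilde :: "('n, 'k) mpoly set \<Rightarrow> ('n + 'n, 'k::comm_ring_1) mpoly set" where
  "tilde J = ideal_gen (rename_vars Inr ` J)"

section \<open>Perfect fields\<close>

definition perfect_field :: "'k::field itself \<Rightarrow> bool" where
  "perfect_field _ \<longleftrightarrow> CHAR('k) = 0 \<or> surj (\<lambda>x::'k. x ^ CHAR('k))"

end

theory Submission
  imports Defs "HOL-Computational_Algebra.Primes" "HOL-Computational_Algebra.Polynomial"
begin

text \<open>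
  Write \<open>x'\<close> for the second set of variables. The Taylor expansion
  \<open>f(x) = \<Sum>\<^sub>m D\<^sup>m f(x') (x - x')\<^sup>m\<close>, whose coefficients are differential operators of order \<open>|m|\<close>
  applied to \<open>f\<close>, shows that the differential power lies in the sum of ideals. Conversely an
  operator \<open>\<delta>\<close> of order less than \<open>n\<close> extends \<open>K[x']\<close>-linearly to \<open>T\<close>, and after identifying
  \<open>x'\<close> with \<open>x\<close> this extension kills \<open>\<Delta>\<^sup>n\<close>, because multiplication by \<open>x\<^sub>i - x'\<^sub>i\<close> replaces \<open>\<delta>\<close>
  by \<open>[\<delta>, x\<^sub>i]\<close>.

  For the second part it remains to compare differential and symbolic powers (Zariski--Nagata)
  at a minimal prime \<open>P\<close> of \<open>J\<close>. The core is the case \<open>n = 2\<close>: if \<open>f\<close> and all its partial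
  derivatives lie in \<open>P\<close>, then \<open>s f \<in> P\<^sup>2\<close> for some \<open>s \<notin> P\<close>. This is proved by adjoining the
  variables one by one to a ring of constants, dividing \<open>f\<close> by a relation of least degree modulo
  \<open>P\<close> for the new variable; the derivative of this relation is not in \<open>P\<close>, which forces the
  quotient into \<open>P\<close>. Hence \<open>P\<close> is generated, locally and modulo \<open>P\<^sup>2\<close>, by elements \<open>u\<^sub>i\<close> whose
  Jacobian matrix contains a nonzero scalar matrix modulo \<open>P\<close>. The monomials of degree \<open>n\<close> in the
  \<open>u\<^sub>i\<close> then have linearly independent leading Taylor coefficients over the residue field, so an
  element of \<open>P\<^sup>n\<close> whose Hasse derivatives of order at most \<open>n\<close> lie in \<open>P\<close> is locally in
  \<open>P\<^bsup>n+1\<^esup>\<close>.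
\<close>

section \<open>Ideals\<close>

lemma is_ideal_iff:
  "is_ideal I \<longleftrightarrow> 0 \<in> I \<and> (\<forall>x\<in>I. \<forall>y\<in>I. x + y \<in> I) \<and> (\<forall>c. \<forall>x\<in>I. c * x \<in> I)"
  by (auto simp: is_ideal_def module.subspace_def[OF module_mult])

lemma idealI:
  assumes "0 \<in> I" "\<And>x y. x \<in> I \<Longrightarrow> y \<in> I \<Longrightarrow> x + y \<in> I" "\<And>c x. x \<in> I \<Longrightarrow> c * x \<in> I"
  shows "is_ideal I"
  using assms by (auto simp: is_ideal_iff)

context
  fixes I :: "'a::comm_ring_1 set"
  assumes I: "is_ideal I"
begin

lemma ideal_zero: "0 \<in> I"
  and ideal_add: "x \<in> I \<Longrightarrow> y \<in> I \<Longrightarrow> x + y \<in> I"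
  and ideal_mult: "x \<in> I \<Longrightarrow> c * x \<in> I"
  using I by (auto simp: is_ideal_iff)

lemma ideal_mult_right: "x \<in> I \<Longrightarrow> x * c \<in> I"
  using ideal_mult[of x c] by (simp add: mult.commute)

lemma ideal_uminus: "x \<in> I \<Longrightarrow> - x \<in> I"
  using ideal_mult[of x "- 1"] by simp

lemma ideal_diff: "x \<in> I \<Longrightarrow> y \<in> I \<Longrightarrow> x - y \<in> I"
  using ideal_add[of x "- y"] ideal_uminus[of y] by simp

lemma ideal_sum_mem: "(\<And>a. a \<in> A \<Longrightarrow> f a \<in> I) \<Longrightarrow> sum f A \<in> I"
  by (induction A rule: infinite_finite_induct) (auto intro: ideal_zero ideal_add)

lemma ideal_eq_UNIV: "1 \<in> I \<Longrightarrow> I = UNIV"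
  using ideal_mult[of 1] by auto

end

lemma is_ideal_gen: "is_ideal (ideal_gen B)"
  unfolding is_ideal_def ideal_gen_def by (rule module.subspace_span[OF module_mult])

lemma ideal_gen_base: "b \<in> B \<Longrightarrow> b \<in> ideal_gen B"
  unfolding ideal_gen_def by (rule module.span_base[OF module_mult])

lemma ideal_gen_induct [consumes 1, case_names zero step]:
  assumes "x \<in> ideal_gen B" "Q 0" "\<And>c b y. b \<in> B \<Longrightarrow> Q y \<Longrightarrow> Q (c * b + y)"
  shows "Q x"
  using assms(1)[unfolded ideal_gen_def]
  by (rule module.span_induct_alt[OF module_mult]) (use assms in auto)

lemma is_ideal_power: "is_ideal (ideal_power I n)"
  by (cases n) (simp_all add: ideal_prod_def is_ideal_gen idealI)

lemma ideal_power_SucI: "a \<in> I \<Longrightarrow> b \<in> ideal_power I n \<Longrightarrow> a * b \<in> ideal_power I (Suc n)"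
  by (auto simp: ideal_prod_def intro: ideal_gen_base)

text \<open>The coefficient of a generator \<open>a * b\<close> is absorbed into \<open>b\<close>,
  which ranges over an ideal, so the step meets bare products only.\<close>

lemma ideal_power_Suc_induct [consumes 1, case_names zero step]:
  assumes "x \<in> ideal_power I (Suc n)" "Q 0"
    and step: "\<And>a b y. a \<in> I \<Longrightarrow> b \<in> ideal_power I n \<Longrightarrow> Q y \<Longrightarrow> Q (a * b + y)"
  shows "Q x"
proof -
  have "x \<in> ideal_gen {a * b | a b. a \<in> I \<and> b \<in> ideal_power I n}"
    using assms(1) by (simp add: ideal_prod_def)
  then show ?thesis
  proof (induction rule: ideal_gen_induct)
    case zero
    show ?case by fact
  next
    case (step c z y)
    then obtain a b where ab: "z = a * b" "a \<in> I" "b \<in> ideal_power I n"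
      by blast
    with assms(3)[of a "c * b" y] step ideal_mult[OF is_ideal_power, of b I n c] show ?case
      by (simp add: mult_ac)
  qed
qed

lemma ideal_power_Suc_subset: "ideal_power I (Suc n) \<subseteq> ideal_power I n"
proof
  fix x assume "x \<in> ideal_power I (Suc n)"
  then show "x \<in> ideal_power I n"
    by (induction rule: ideal_power_Suc_induct)
      (auto intro: ideal_zero ideal_add ideal_mult is_ideal_power)
qed

lemma ideal_power_antimono: "m \<le> n \<Longrightarrow> ideal_power I n \<subseteq> ideal_power I m"
  by (induction rule: dec_induct) (use ideal_power_Suc_subset in blast)+

lemma ideal_power_one:
  assumes "is_ideal I"
  shows "ideal_power I 1 = I"
proof
  show "ideal_power I 1 \<subseteq> I"
  proof
    fix x assume "x \<in> ideal_power I 1"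
    then have "x \<in> ideal_power I (Suc 0)" by simp
    then show "x \<in> I"
      by (induction rule: ideal_power_Suc_induct)
        (use assms in \<open>auto intro: ideal_zero ideal_add ideal_mult_right\<close>)
  qed
  show "I \<subseteq> ideal_power I 1"
    using ideal_power_SucI[of _ I 1 0] by auto
qed

lemma mult_mem_ideal_square:
  assumes "is_ideal I" "a \<in> I" "b \<in> I"
  shows "a * b \<in> ideal_power I 2"
  using ideal_power_SucI[of a I b 1] assms ideal_power_one[OF assms(1)]
  by (simp add: numeral_2_eq_2)

section \<open>Prime ideals\<close>

context
  fixes P :: "'a::comm_ring_1 set"
  assumes P: "prime_ideal P"
begin

lemma prime_is_ideal: "is_ideal P"
  using P by (simp add: prime_ideal_def)

lemma prime_one: "1 \<notin> P"
  using P ideal_eq_UNIV by (auto simp: prime_ideal_def)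

lemma prime_mult_iff: "a * b \<in> P \<longleftrightarrow> a \<in> P \<or> b \<in> P"
  using P ideal_mult ideal_mult_right by (auto simp: prime_ideal_def)

lemma prime_power: "a \<notin> P \<Longrightarrow> a ^ n \<notin> P"
  by (induction n) (auto simp: prime_one prime_mult_iff)

lemma prime_prod: "finite A \<Longrightarrow> (\<And>a. a \<in> A \<Longrightarrow> f a \<notin> P) \<Longrightarrow> prod f A \<notin> P"
  by (induction A rule: finite_induct) (auto simp: prime_one prime_mult_iff)

end

text \<open>Multipliers outside \<open>P\<close> play the role of denominators in the localization
  at \<open>P\<close>. The product of finitely many of them serves all elements at once and stays
  outside the prime.\<close>

lemma common_multiplier:
  assumes P: "prime_ideal P" and I: "is_ideal I" and "finite A"
    and "\<And>a. a \<in> A \<Longrightarrow> \<exists>s. s \<notin> P \<and> s * f a \<in> I"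
  shows "\<exists>s. s \<notin> P \<and> (\<forall>a\<in>A. s * f a \<in> I)"
proof -
  obtain s where s: "\<And>a. a \<in> A \<Longrightarrow> s a \<notin> P \<and> s a * f a \<in> I"
    using assms(4) by metis
  have "prod s A * f a \<in> I" if "a \<in> A" for a
  proof -
    have "prod s A * f a = prod s (A - {a}) * (s a * f a)"
      using prod.remove[OF \<open>finite A\<close> that, of s] by (simp add: mult_ac)
    then show ?thesis
      using s[OF that] ideal_mult[OF I] by simp
  qed
  then show ?thesis
    using prime_prod[OF P \<open>finite A\<close>] s by blast
qed

section \<open>Prime ideals from Zorn's lemma\<close>

lemma ideal_add_principal:
  assumes "is_ideal I"
  shows "is_ideal {a + c * x | a c. a \<in> I}" (is "is_ideal ?I")
proof (rule idealI)
  show "0 \<in> ?I"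
    using ideal_zero[OF assms] by (intro CollectI exI[of _ 0]) simp
next
  fix u v assume "u \<in> ?I" "v \<in> ?I"
  then obtain a c a' c' where uv: "u = a + c * x" "v = a' + c' * x" "a \<in> I" "a' \<in> I"
    by blast
  then have "u + v = (a + a') + (c + c') * x"
    by (simp add: algebra_simps)
  with uv ideal_add[OF assms] show "u + v \<in> ?I"
    by blast
next
  fix r u assume "u \<in> ?I"
  then obtain a c where u: "u = a + c * x" "a \<in> I"
    by blast
  then have "r * u = r * a + (r * c) * x"
    by (simp add: algebra_simps)
  with u ideal_mult[OF assms] show "r * u \<in> ?I"
    by blast
qed

lemma is_ideal_Union_chain:
  assumes "C \<noteq> {}" "\<And>I. I \<in> C \<Longrightarrow> is_ideal I" "\<And>I J. I \<in> C \<Longrightarrow> J \<in> C \<Longrightarrow> I \<subseteq> J \<or> J \<subseteq> I"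
  shows "is_ideal (\<Union>C)"
proof (rule idealI)
  show "0 \<in> \<Union>C"
    using assms(1,2) ideal_zero by blast
next
  fix x y assume "x \<in> \<Union>C" "y \<in> \<Union>C"
  then obtain I J where IJ: "I \<in> C" "J \<in> C" "x \<in> I" "y \<in> J"
    by blast
  with assms(3)[of I J] obtain L where "L \<in> C" "x \<in> L" "y \<in> L"
    by blast
  then show "x + y \<in> \<Union>C"
    using assms(2) ideal_add by blast
next
  fix c x assume "x \<in> \<Union>C"
  then show "c * x \<in> \<Union>C"
    using assms(2) ideal_mult by blast
qed

text \<open>An ideal \<open>Q\<close> maximal among those over \<open>I\<close> that miss
  \<open>M\<close> is prime: if \<open>a\<close> and \<open>b\<close> were outside \<open>Q\<close>,
  enlarging \<open>Q\<close> by either would meet \<open>M\<close>, and the product of the two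
  meeting points would lie in \<open>M\<close> and, since \<open>a * b\<close> is in
  \<open>Q\<close>, also in \<open>Q\<close>.\<close>

lemma prime_ideal_avoiding:
  assumes I: "is_ideal I" and M: "1 \<in> M" "\<And>a b. a \<in> M \<Longrightarrow> b \<in> M \<Longrightarrow> a * b \<in> M"
    and disj: "I \<inter> M = {}"
  obtains Q where "prime_ideal Q" "I \<subseteq> Q" "Q \<inter> M = {}"
proof -
  define \<A> where "\<A> = {Q. is_ideal Q \<and> I \<subseteq> Q \<and> Q \<inter> M = {}}"
  have "\<exists>Q\<in>\<A>. \<forall>X\<in>\<A>. Q \<subseteq> X \<longrightarrow> X = Q"
  proof (rule subset_Zorn_nonempty)
    show "\<A> \<noteq> {}"
      using I disj by (auto simp: \<A>_def)
  next
    fix C assume C: "C \<noteq> {}" "subset.chain \<A> C"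
    then have "is_ideal (\<Union>C)"
      by (intro is_ideal_Union_chain) (auto simp: \<A>_def subset_chain_def)
    with C show "\<Union>C \<in> \<A>"
      by (auto simp: \<A>_def subset_chain_def)
  qed
  then obtain Q where Q: "is_ideal Q" "I \<subseteq> Q" "Q \<inter> M = {}"
    and max: "\<And>X. X \<in> \<A> \<Longrightarrow> Q \<subseteq> X \<Longrightarrow> X = Q"
    by (auto simp: \<A>_def)
  have meet: "\<exists>q c. q \<in> Q \<and> q + c * x \<in> M" if "x \<notin> Q" for x
  proof (rule ccontr)
    assume no: "\<nexists>q c. q \<in> Q \<and> q + c * x \<in> M"
    let ?X = "{a + c * x | a c. a \<in> Q}"
    have "q = q + 0 * x" for q
      by simp
    then have sub: "Q \<subseteq> ?X"
      by blast
    moreover have "?X \<in> \<A>"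
      using ideal_add_principal[OF Q(1)] Q(2) sub no by (auto simp: \<A>_def)
    ultimately have "?X = Q"
      using max by blast
    moreover have "x = 0 + 1 * x"
      by simp
    with ideal_zero[OF Q(1)] have "x \<in> ?X"
      by blast
    ultimately show False
      using that by blast
  qed
  have "a \<in> Q \<or> b \<in> Q" if ab: "a * b \<in> Q" for a b
  proof (rule ccontr)
    assume "\<not> (a \<in> Q \<or> b \<in> Q)"
    then obtain q c q' c' where q: "q \<in> Q" "q + c * a \<in> M" "q' \<in> Q" "q' + c' * b \<in> M"
      using meet by meson
    have "(q + c * a) * (q' + c' * b) = (q' + c' * b) * q + (c * a) * q' + (c * c') * (a * b)"
      by (simp add: algebra_simps)
    also have "\<dots> \<in> Q"
      using q ab by (simp add: ideal_add[OF Q(1)] ideal_mult[OF Q(1)])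
    finally show False
      using M(2)[OF q(2,4)] Q(3) by blast
  qed
  moreover have "Q \<noteq> UNIV"
    using Q(3) M(1) by blast
  ultimately have "prime_ideal Q"
    using Q(1) by (auto simp: prime_ideal_def)
  with Q that show ?thesis
    by blast
qed

text \<open>Zorn's lemma yields maximal elements, so it is applied to complements of primes. The
  union of a chain of complements is the complement of an intersection of a chain of primes, which
  is again prime.\<close>

lemma minimal_prime_below:
  assumes "prime_ideal Q" "I \<subseteq> Q"
  obtains P where "P \<in> minimal_primes I" "P \<subseteq> Q"
proof -
  define \<A> where "\<A> = {- P | P. prime_ideal P \<and> I \<subseteq> P \<and> P \<subseteq> Q}"
  have "\<exists>M\<in>\<A>. \<forall>X\<in>\<A>. M \<subseteq> X \<longrightarrow> X = M"
  proof (rule subset_Zorn_nonempty)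
    show "\<A> \<noteq> {}"
      using assms by (auto simp: \<A>_def)
  next
    fix C assume C: "C \<noteq> {}" "subset.chain \<A> C"
    then have CA: "C \<subseteq> \<A>" and chain: "\<And>X Y. X \<in> C \<Longrightarrow> Y \<in> C \<Longrightarrow> X \<subseteq> Y \<or> Y \<subseteq> X"
      by (auto simp: subset_chain_def)
    have pr: "prime_ideal (- X)" "I \<subseteq> - X" "- X \<subseteq> Q" if "X \<in> C" for X
      using that CA by (auto simp: \<A>_def)
    let ?P = "- \<Union>C"
    have X: "is_ideal (- X)" if "X \<in> C" for X
      using pr(1)[OF that] by (rule prime_is_ideal)
    have "is_ideal (\<Inter>X\<in>C. - X)"
    proof (rule idealI; rule INT_I)
      fix X assume "X \<in> C"
      then show "0 \<in> - X"
        using ideal_zero[OF X, of X] by simp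
    next
      fix x y X assume "x \<in> (\<Inter>X\<in>C. - X)" "y \<in> (\<Inter>X\<in>C. - X)" "X \<in> C"
      then show "x + y \<in> - X"
        using ideal_add[OF X, of X x y] by blast
    next
      fix c x X assume "x \<in> (\<Inter>X\<in>C. - X)" "X \<in> C"
      then show "c * x \<in> - X"
        using ideal_mult[OF X, of X x c] by blast
    qed
    then have "is_ideal ?P"
      by (simp only: uminus_Sup)
    moreover have "a \<in> ?P \<or> b \<in> ?P" if ab: "a * b \<in> ?P" for a b
    proof (rule ccontr)
      assume "\<not> (a \<in> ?P \<or> b \<in> ?P)"
      then obtain X Y where XY: "X \<in> C" "Y \<in> C" "a \<in> X" "b \<in> Y"
        by blast
      with chain[of X Y] obtain Z where Z: "Z \<in> C" "a \<in> Z" "b \<in> Z"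
        by blast
      with prime_mult_iff[OF pr(1)[OF Z(1)], of a b] ab show False
        by blast
    qed
    moreover obtain X where "X \<in> C"
      using C(1) by blast
    then have "1 \<in> X"
      using prime_one[OF pr(1)] by blast
    then have "?P \<noteq> UNIV"
      using \<open>X \<in> C\<close> by blast
    ultimately have "prime_ideal ?P"
      unfolding prime_ideal_def by blast
    moreover have "I \<subseteq> ?P"
      using pr(2) by blast
    moreover have "?P \<subseteq> Q"
      using pr(3)[OF \<open>X \<in> C\<close>] \<open>X \<in> C\<close> by blast
    ultimately have "- ?P \<in> \<A>"
      unfolding \<A>_def by blast
    then show "\<Union>C \<in> \<A>"
      by simp
  qed
  then obtain M where "M \<in> \<A>" and max: "\<And>X. X \<in> \<A> \<Longrightarrow> M \<subseteq> X \<Longrightarrow> X = M"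
    by blast
  then obtain P where M: "M = - P" and P: "prime_ideal P" "I \<subseteq> P" "P \<subseteq> Q"
    unfolding \<A>_def by blast
  have "P' = P" if "prime_ideal P'" "I \<subseteq> P'" "P' \<subseteq> P" for P'
  proof -
    have "- P' \<in> \<A>"
      unfolding \<A>_def using that P(3) by blast
    with max[of "- P'"] that M show ?thesis
      by auto
  qed
  with P have "P \<in> minimal_primes I"
    unfolding minimal_primes_def by blast
  with P that show ?thesis
    by blast
qed

text \<open>If \<open>x\<close> is outside the radical ideal \<open>J\<close>, so are its powers. A
  minimal prime inside a prime over \<open>J\<close> that avoids these powers misses
  \<open>x\<close>.\<close>

lemma radical_ideal_minimal_primes:
  assumes J: "radical_ideal J" and "\<And>P. P \<in> minimal_primes J \<Longrightarrow> x \<in> P"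
  shows "x \<in> J"
proof (rule ccontr)
  assume x: "x \<notin> J"
  have idJ: "is_ideal J" and rad: "radical J = J"
    using J by (auto simp: radical_ideal_def)
  define M where "M = {x ^ k | k. True}"
  have disj: "J \<inter> M = {}"
    using x rad by (auto simp: M_def radical_def)
  have "1 = x ^ 0" "x = x ^ 1"
    by simp_all
  then have one: "1 \<in> M" and xM: "x \<in> M"
    unfolding M_def by blast+
  have mult: "a * b \<in> M" if ab: "a \<in> M" "b \<in> M" for a b
  proof -
    obtain k l where "a = x ^ k" "b = x ^ l"
      using ab by (auto simp: M_def)
    then have "a * b = x ^ (k + l)"
      by (simp add: power_add)
    then show ?thesis
      unfolding M_def by blast
  qed
  obtain Q where Q: "prime_ideal Q" "J \<subseteq> Q" "Q \<inter> M = {}"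
    using prime_ideal_avoiding[OF idJ one mult disj] by blast
  then obtain P where "P \<in> minimal_primes J" "P \<subseteq> Q"
    using minimal_prime_below by blast
  with assms(2) Q(3) xM show False
    by blast
qed

text \<open>So \<open>J\<close> and \<open>P\<close> agree after localizing at \<open>P\<close>. If
  \<open>J\<close> missed all \<open>s * p ^ k\<close> with \<open>s\<close> outside
  \<open>P\<close>, a prime over \<open>J\<close> avoiding them would lie inside \<open>P\<close>
  without containing \<open>p\<close>, against minimality. Radicality then removes the
  exponent.\<close>

lemma minimal_prime_radical_multiplier:
  assumes J: "radical_ideal J" and P: "P \<in> minimal_primes J" and "p \<in> P"
  shows "\<exists>s. s \<notin> P \<and> s * p \<in> J"
proof -
  have idJ: "is_ideal J" and rad: "radical J = J"
    using J by (auto simp: radical_ideal_def)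
  have pr: "prime_ideal P" and JP: "J \<subseteq> P"
    and min: "\<And>Q. prime_ideal Q \<Longrightarrow> J \<subseteq> Q \<Longrightarrow> Q \<subseteq> P \<Longrightarrow> Q = P"
    using P by (auto simp: minimal_primes_def)
  define M where "M = {s * p ^ k | s k. s \<notin> P}"
  have one: "1 \<in> M"
    unfolding M_def using prime_one[OF pr]
    by (intro CollectI, rule_tac exI[of _ 1], rule_tac exI[of _ 0]) simp
  have mult: "a * b \<in> M" if "a \<in> M" "b \<in> M" for a b
  proof -
    from that obtain s k s' k' where "a = s * p ^ k" "b = s' * p ^ k'" "s \<notin> P" "s' \<notin> P"
      by (auto simp: M_def)
    then have "a * b = (s * s') * p ^ (k + k')" "s * s' \<notin> P"
      using prime_mult_iff[OF pr] by (simp_all add: power_add mult_ac)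
    then show ?thesis
      unfolding M_def by blast
  qed
  have "J \<inter> M \<noteq> {}"
  proof
    assume "J \<inter> M = {}"
    then obtain Q where Q: "prime_ideal Q" "J \<subseteq> Q" "Q \<inter> M = {}"
      using prime_ideal_avoiding[OF idJ one mult] by blast
    have "s \<in> M" if "s \<notin> P" for s
      unfolding M_def using that
      by (intro CollectI, rule_tac exI[of _ s], rule_tac exI[of _ 0]) simp
    with Q have "Q = P"
      by (intro min) auto
    moreover have "p \<in> M"
      unfolding M_def using prime_one[OF pr]
      by (intro CollectI, rule_tac exI[of _ 1], rule_tac exI[of _ 1]) simp
    ultimately show False
      using Q(3) \<open>p \<in> P\<close> by blast
  qed
  then obtain s k where s: "s \<notin> P" "s * p ^ k \<in> J"
    by (auto simp: M_def)
  \<comment> \<open>For \<open>k = 0\<close> the element \<open>s\<close> itself would be in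
    \<open>J\<close>, hence in \<open>P\<close>.\<close>
  have "k \<noteq> 0"
    using s JP by (cases k) auto
  then have "(s * p) ^ k = s ^ (k - 1) * (s * p ^ k)"
    by (cases k) (simp_all add: power_mult_distrib mult_ac)
  then have "(s * p) ^ k \<in> J"
    using s ideal_mult[OF idJ] by simp
  then have "s * p \<in> J"
    using rad by (auto simp: radical_def)
  with s show ?thesis
    by blast
qed

text \<open>A finite sum in the extension is brought over a common denominator outside
  \<open>P\<close>. This turns symbolic powers into statements about multipliers, without
  fractions.\<close>

lemma Fract_mem_extension_iff:
  fixes P :: "'a::idom set"
  assumes P: "prime_ideal P" and I: "is_ideal I"
  shows "Fract f 1 \<in> extension P I \<longleftrightarrow> (\<exists>s. s \<notin> P \<and> s * f \<in> I)"
proof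
  have P0: "s \<noteq> 0" if "s \<notin> P" for s
    using that ideal_zero[OF prime_is_ideal[OF P]] by blast
  {
    assume "Fract f 1 \<in> extension P I"
    then obtain A r where A: "finite A" "A \<subseteq> I" "r ` A \<subseteq> localization P"
      and f: "Fract f 1 = (\<Sum>a\<in>A. r a * Fract a 1)"
      unfolding extension_def by blast
    from A have "\<exists>c s. s \<notin> P \<and> c \<in> I \<and> (\<Sum>a\<in>A. r a * Fract a 1) = Fract c s"
    proof (induction A rule: finite_induct)
      case empty
      then show ?case
        using prime_one[OF P] ideal_zero[OF I] by (auto simp: Zero_fract_def)
    next
      case (insert x A)
      then obtain c s where c: "s \<notin> P" "c \<in> I" "(\<Sum>a\<in>A. r a * Fract a 1) = Fract c s"
        by auto
      from insert obtain b t where b: "r x = Fract b t" "t \<notin> P"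
        by (auto simp: localization_def)
      have "(\<Sum>a\<in>insert x A. r a * Fract a 1) = Fract (b * x * s + c * t) (t * s)"
        using insert b c P0 by simp
      moreover have "b * x * s + c * t \<in> I"
        using ideal_add[OF I ideal_mult_right[OF I ideal_mult[OF I]] ideal_mult_right[OF I c(2)]]
          insert.prems(1) by simp
      moreover have "t * s \<notin> P"
        using prime_mult_iff[OF P] b c by blast
      ultimately show ?case
        by blast
    qed
    then obtain c s where "s \<notin> P" "c \<in> I" "Fract f 1 = Fract c s"
      using f by auto
    then show "\<exists>s. s \<notin> P \<and> s * f \<in> I"
      using P0 by (auto simp: eq_fract mult.commute)
  }
  {
    assume "\<exists>s. s \<notin> P \<and> s * f \<in> I"
    then obtain s where s: "s \<notin> P" "s * f \<in> I"
      by blast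
    have "(\<Sum>a\<in>{s * f}. Fract 1 s * Fract a 1) = Fract f 1"
      using P0[OF s(1)] by (simp add: eq_fract mult.commute)
    moreover have "(\<lambda>_. Fract 1 s) ` {s * f} \<subseteq> localization P"
      using s by (auto simp: localization_def)
    ultimately show "Fract f 1 \<in> extension P I"
      unfolding extension_def using s
      by (intro CollectI exI[of _ "{s * f}"] exI[of _ "\<lambda>_. Fract 1 s"]) auto
  }
qed

lemma mem_symbolic_power_iff:
  "f \<in> symbolic_power J n \<longleftrightarrow>
     (\<forall>P\<in>minimal_primes J. \<exists>s. s \<notin> P \<and> s * f \<in> ideal_power J n)"
  by (auto simp: symbolic_power_def minimal_primes_def Fract_mem_extension_iff is_ideal_power)

section \<open>Evaluation of polynomials\<close>

abbreviation lookup :: "('a \<Rightarrow>\<^sub>0 'b::zero) \<Rightarrow> 'a \<Rightarrow> 'b" where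
  "lookup \<equiv> Poly_Mapping.lookup"

abbreviation keys :: "('a \<Rightarrow>\<^sub>0 'b::zero) \<Rightarrow> 'a set" where
  "keys \<equiv> Poly_Mapping.keys"

abbreviation single :: "'a \<Rightarrow> 'b \<Rightarrow> 'a \<Rightarrow>\<^sub>0 'b::zero" where
  "single \<equiv> Poly_Mapping.single"

definition is_ring_hom :: "('a::comm_ring_1 \<Rightarrow> 'b::comm_ring_1) \<Rightarrow> bool" where
  "is_ring_hom \<phi> \<longleftrightarrow>
     \<phi> 1 = 1 \<and> (\<forall>x y. \<phi> (x + y) = \<phi> x + \<phi> y) \<and> (\<forall>x y. \<phi> (x * y) = \<phi> x * \<phi> y)"

lemma is_ring_homI:
  assumes "\<phi> 1 = 1" "\<And>x y. \<phi> (x + y) = \<phi> x + \<phi> y" "\<And>x y. \<phi> (x * y) = \<phi> x * \<phi> y"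
  shows "is_ring_hom \<phi>"
  using assms by (simp add: is_ring_hom_def)

context
  fixes \<phi> :: "'a::comm_ring_1 \<Rightarrow> 'b::comm_ring_1"
  assumes \<phi>: "is_ring_hom \<phi>"
begin

lemma hom_one: "\<phi> 1 = 1"
  and hom_add: "\<phi> (x + y) = \<phi> x + \<phi> y"
  and hom_mult: "\<phi> (x * y) = \<phi> x * \<phi> y"
  using \<phi> by (auto simp: is_ring_hom_def)

lemma hom_zero: "\<phi> 0 = 0"
  using hom_add[of 0 0] by simp

lemma hom_diff: "\<phi> (x - y) = \<phi> x - \<phi> y"
  using hom_add[of "x - y" y] by simp

lemma hom_power: "\<phi> (x ^ n) = \<phi> x ^ n"
  by (induction n) (simp_all add: hom_one hom_mult)

lemma hom_sum: "\<phi> (sum f A) = (\<Sum>a\<in>A. \<phi> (f a))"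
  by (induction A rule: infinite_finite_induct) (simp_all add: hom_zero hom_add)

lemma hom_prod: "\<phi> (prod f A) = (\<Prod>a\<in>A. \<phi> (f a))"
  by (induction A rule: infinite_finite_induct) (simp_all add: hom_one hom_mult)

end

lemma is_ring_hom_comp: "is_ring_hom f \<Longrightarrow> is_ring_hom g \<Longrightarrow> is_ring_hom (\<lambda>x. g (f x))"
  by (simp add: is_ring_hom_def)

lemma is_ring_hom_id: "is_ring_hom (\<lambda>x. x)"
  by (simp add: is_ring_hom_def)

lemma is_ring_hom_Const: "is_ring_hom Const"
  by (simp add: is_ring_hom_def Const_def single_add mult_single)

lemma sum_single_lookup:
  "(\<Sum>m\<in>keys p. single m (lookup p m)) = (p :: 'a \<Rightarrow>\<^sub>0 'b::comm_monoid_add)"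
  by (rule poly_mapping_eqI) (simp add: lookup_sum lookup_single when_def in_keys_iff)

lemma poly_mapping_single_induct [case_names single add]:
  fixes p :: "'a \<Rightarrow>\<^sub>0 'b::comm_monoid_add"
  assumes "\<And>m c. Q (single m c)" "\<And>p q. Q p \<Longrightarrow> Q q \<Longrightarrow> Q (p + q)"
  shows "Q p"
proof -
  have "Q (\<Sum>m\<in>A. single m (lookup p m))" if "finite A" for A
    using that
  proof (induction A rule: finite_induct)
    case empty
    then show ?case
      using assms(1)[of _ 0] by simp
  qed (use assms in simp)
  from this[OF finite_keys, of p] show ?thesis
    by (simp add: sum_single_lookup)
qed

lemma sum_single_lookup_UNIV: "(\<Sum>i\<in>UNIV. single i (lookup m i)) = (m :: 'v::finite \<Rightarrow>\<^sub>0 nat)"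
  by (rule poly_mapping_eqI) (simp add: lookup_sum lookup_single when_def)

lemma Var_power: "(Var i :: ('v, 'a::comm_ring_1) mpoly) ^ k = single (single i k) 1"
  by (induction k) (simp_all add: Var_def mult_single flip: single_add)

lemma prod_single: "(\<Prod>i\<in>A. single (f i) (1::'a::comm_ring_1)) = single (\<Sum>i\<in>A. f i :: _ \<Rightarrow>\<^sub>0 nat) 1"
  by (induction A rule: infinite_finite_induct) (simp_all add: mult_single)

lemma single_eq_Const_mult_Var:
  "single m c = Const c * (\<Prod>i\<in>UNIV. (Var i :: ('v::finite, 'a::comm_ring_1) mpoly) ^ lookup m i)"
  by (simp add: Var_power prod_single sum_single_lookup_UNIV Const_def mult_single)

lemma mpoly_induct [case_names Const Var add mult]:
  fixes p :: "('v::finite, 'a::comm_ring_1) mpoly"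
  assumes "\<And>c. Q (Const c)" "\<And>i. Q (Var i)"
    and add: "\<And>p q. Q p \<Longrightarrow> Q q \<Longrightarrow> Q (p + q)" and mult: "\<And>p q. Q p \<Longrightarrow> Q q \<Longrightarrow> Q (p * q)"
  shows "Q p"
proof (induction p rule: poly_mapping_single_induct)
  case (single m c)
  have one: "Q 1"
    using assms(1)[of 1] by (simp add: Const_def)
  then have pow: "Q (Var i ^ k)" for i k
    by (induction k) (simp_all add: assms(2) mult)
  have "Q (\<Prod>i\<in>A. Var i ^ lookup m i)" if "finite A" for A
    using that by (induction A rule: finite_induct) (simp_all add: one pow mult)
  from this[of UNIV] show ?case
    by (simp add: single_eq_Const_mult_Var assms(1) mult)
next
  case (add p q)
  then show ?case
    by (rule assms(3))
qed

text \<open>Uniqueness in the universal property of the polynomial ring; it identifies composite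
  substitutions by their values on constants and variables.\<close>

lemma ring_hom_mpoly_eq:
  fixes p :: "('v::finite, 'a::comm_ring_1) mpoly"
  assumes "is_ring_hom f" "is_ring_hom g" "\<And>c. f (Const c) = g (Const c)"
    "\<And>i. f (Var i) = g (Var i)"
  shows "f p = g p"
  by (induction p rule: mpoly_induct)
    (simp_all add: assms hom_add[OF assms(1)] hom_add[OF assms(2)]
      hom_mult[OF assms(1)] hom_mult[OF assms(2)])

definition mpoly_eval ::
    "('a::comm_ring_1 \<Rightarrow> 'b::comm_ring_1) \<Rightarrow> ('v::finite \<Rightarrow> 'b) \<Rightarrow> ('v, 'a) mpoly \<Rightarrow> 'b" where
  "mpoly_eval \<phi> a p = (\<Sum>m\<in>keys p. \<phi> (lookup p m) * (\<Prod>i\<in>UNIV. a i ^ lookup m i))"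

context
  fixes \<phi> :: "'a::comm_ring_1 \<Rightarrow> 'b::comm_ring_1" and a :: "'v::finite \<Rightarrow> 'b"
  assumes \<phi>: "is_ring_hom \<phi>"
begin

lemma mpoly_eval_single:
  "mpoly_eval \<phi> a (single m c) = \<phi> c * (\<Prod>i\<in>UNIV. a i ^ lookup m i)"
  by (simp add: mpoly_eval_def hom_zero[OF \<phi>])

lemma mpoly_eval_add: "mpoly_eval \<phi> a (p + q) = mpoly_eval \<phi> a p + mpoly_eval \<phi> a q"
  unfolding mpoly_eval_def
  by (rule setsum_keys_plus_distrib) (simp_all add: hom_zero[OF \<phi>] hom_add[OF \<phi>] algebra_simps)

lemma mpoly_eval_single_mult:
  "mpoly_eval \<phi> a (single m c * single n d)
     = mpoly_eval \<phi> a (single m c) * mpoly_eval \<phi> a (single n d)"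
  by (simp add: mult_single mpoly_eval_single hom_mult[OF \<phi>] lookup_add power_add
      prod.distrib mult_ac)

lemma is_ring_hom_mpoly_eval: "is_ring_hom (mpoly_eval \<phi> a)"
proof (rule is_ring_homI)
  show "mpoly_eval \<phi> a 1 = 1"
    using mpoly_eval_single[of 0 1] by (simp add: hom_one[OF \<phi>])
  show "mpoly_eval \<phi> a (p + q) = mpoly_eval \<phi> a p + mpoly_eval \<phi> a q" for p q
    by (rule mpoly_eval_add)
  have *: "mpoly_eval \<phi> a (single m c * q) = mpoly_eval \<phi> a (single m c) * mpoly_eval \<phi> a q"
    for m c q
    by (induction q rule: poly_mapping_single_induct)
      (simp_all add: mpoly_eval_single_mult mpoly_eval_add algebra_simps)
  show "mpoly_eval \<phi> a (p * q) = mpoly_eval \<phi> a p * mpoly_eval \<phi> a q" for p q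
    by (induction p rule: poly_mapping_single_induct)
      (simp_all add: * mpoly_eval_add distrib_right)
qed

lemma mpoly_eval_Const: "mpoly_eval \<phi> a (Const c) = \<phi> c"
  by (simp add: Const_def mpoly_eval_single)

lemma mpoly_eval_Var: "mpoly_eval \<phi> a (Var i) = a i"
proof -
  have "a j ^ lookup (single i (1::nat)) j = (if i = j then a i else 1)" for j
    by (simp add: lookup_single when_def)
  then show ?thesis
    by (simp add: Var_def mpoly_eval_single hom_one[OF \<phi>])
qed

end

lemma rename_vars_eq_mpoly_eval:
  "rename_vars \<psi> p = mpoly_eval Const (\<lambda>i. Var (\<psi> i)) (p :: ('v::finite, 'a::comm_ring_1) mpoly)"
  unfolding rename_vars_def mpoly_eval_def
  by (intro sum.cong refl arg_cong2[where f = "(*)"] prod.mono_neutral_left)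
    (auto simp: in_keys_iff)

lemma is_ring_hom_rename_vars:
  "is_ring_hom (rename_vars \<psi> :: ('v::finite, 'a::comm_ring_1) mpoly \<Rightarrow> _)"
  unfolding rename_vars_eq_mpoly_eval[abs_def]
  by (rule is_ring_hom_mpoly_eval[OF is_ring_hom_Const])

lemma rename_vars_Const: "rename_vars \<psi> (Const c :: ('v::finite, 'a::comm_ring_1) mpoly) = Const c"
  by (simp add: rename_vars_eq_mpoly_eval mpoly_eval_Const is_ring_hom_Const)

lemma rename_vars_Var:
  "rename_vars \<psi> (Var i :: ('v::finite, 'a::comm_ring_1) mpoly) = Var (\<psi> i)"
  by (simp add: rename_vars_eq_mpoly_eval mpoly_eval_Var is_ring_hom_Const)

section \<open>Polynomials whose low coefficients lie in an ideal\<close>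

definition total_degree :: "('v::finite \<Rightarrow>\<^sub>0 nat) \<Rightarrow> nat" where
  "total_degree m = (\<Sum>i\<in>UNIV. lookup m i)"

lemma total_degree_add: "total_degree (m + n) = total_degree m + total_degree n"
  by (simp add: total_degree_def lookup_add sum.distrib)

lemma total_degree_single: "total_degree (single i k) = k"
  by (simp add: total_degree_def lookup_single when_def)

lemma total_degree_zero: "total_degree 0 = 0"
  by (simp add: total_degree_def)

lemma total_degree_eq_0_iff: "total_degree m = 0 \<longleftrightarrow> m = 0"
  by (auto simp: total_degree_def intro: poly_mapping_eqI)

text \<open>For an ideal \<open>P\<close>: after reducing coefficients modulo \<open>P\<close> and
  setting the variables outside \<open>I\<close> to zero, the polynomial has order at least
  \<open>d\<close>.\<close>

definition low_coeffs_in ::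
    "'a::comm_ring_1 set \<Rightarrow> 'v::finite set \<Rightarrow> nat \<Rightarrow> ('v, 'a) mpoly set" where
  "low_coeffs_in P I d = {F. \<forall>m. keys m \<subseteq> I \<longrightarrow> total_degree m < d \<longrightarrow> lookup F m \<in> P}"

lemma low_coeffs_inD:
  "F \<in> low_coeffs_in P I d \<Longrightarrow> keys m \<subseteq> I \<Longrightarrow> total_degree m < d \<Longrightarrow> lookup F m \<in> P"
  by (simp add: low_coeffs_in_def)

lemma low_coeffs_in_0: "low_coeffs_in P I 0 = UNIV"
  by (simp add: low_coeffs_in_def)

lemma low_coeffs_in_antimono: "d \<le> e \<Longrightarrow> low_coeffs_in P I e \<subseteq> low_coeffs_in P I d"
  by (auto simp: low_coeffs_in_def)

lemma lookup_Const_mult: "lookup (Const c * F) m = c * lookup F m"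
  by (induction F rule: poly_mapping_single_induct)
    (simp_all add: Const_def mult_single lookup_single when_def lookup_add algebra_simps)

lemma lookup_mult_mem_ideal:
  fixes F G :: "('v, 'a::comm_ring_1) mpoly"
  assumes P: "is_ideal P"
    and "\<And>k l. m = k + l \<Longrightarrow> lookup F k * lookup G l \<in> P"
  shows "lookup (F * G) m \<in> P"
proof -
  have "F * G = (\<Sum>k\<in>keys F. single k (lookup F k)) * (\<Sum>l\<in>keys G. single l (lookup G l))"
    by (simp only: sum_single_lookup)
  also have "\<dots> = (\<Sum>k\<in>keys F. \<Sum>l\<in>keys G. single (k + l) (lookup F k * lookup G l))"
    by (simp add: sum_product mult_single)
  finally have "lookup (F * G) m
      = (\<Sum>k\<in>keys F. \<Sum>l\<in>keys G. lookup F k * lookup G l when k + l = m)"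
    by (simp add: lookup_sum lookup_single)
  also have "\<dots> \<in> P"
    using assms(2) ideal_zero[OF P]
    by (intro ideal_sum_mem[OF P]) (auto simp: when_def)
  finally show ?thesis .
qed

context
  fixes P :: "'a::comm_ring_1 set" and I :: "'v::finite set"
  assumes P: "is_ideal P"
begin

text \<open>Orders add: if \<open>k + l\<close> has degree below \<open>d + e\<close>, then
  \<open>k\<close> has degree below \<open>d\<close> or \<open>l\<close> below
  \<open>e\<close>.\<close>

lemma low_coeffs_in_mult:
  assumes "F \<in> low_coeffs_in P I d" "G \<in> low_coeffs_in P I e"
  shows "F * G \<in> low_coeffs_in P I (d + e)"
  unfolding low_coeffs_in_def
proof (intro CollectI allI impI lookup_mult_mem_ideal[OF P])
  fix m k l :: "'v \<Rightarrow>\<^sub>0 nat"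
  assume m: "keys m \<subseteq> I" "total_degree m < d + e" "m = k + l"
  have "keys k \<subseteq> keys m" "keys l \<subseteq> keys m"
    using m(3) by (auto simp: in_keys_iff lookup_add)
  then have I: "keys k \<subseteq> I" "keys l \<subseteq> I"
    using m(1) by blast+
  consider "total_degree k < d" | "total_degree l < e"
    using m(2) unfolding m(3) total_degree_add by linarith
  then show "lookup F k * lookup G l \<in> P"
  proof cases
    case 1
    then show ?thesis
      by (intro ideal_mult_right[OF P] low_coeffs_inD[OF assms(1) I(1)])
  next
    case 2
    then show ?thesis
      by (intro ideal_mult[OF P] low_coeffs_inD[OF assms(2) I(2)])
  qed
qed

lemma is_ideal_low_coeffs_in: "is_ideal (low_coeffs_in P I d)"
proof (rule idealI)
  show "0 \<in> low_coeffs_in P I d"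
    by (simp add: low_coeffs_in_def ideal_zero[OF P])
  show "F + G \<in> low_coeffs_in P I d"
    if "F \<in> low_coeffs_in P I d" "G \<in> low_coeffs_in P I d" for F G
    using that by (simp add: low_coeffs_in_def lookup_add ideal_add[OF P])
  show "F * G \<in> low_coeffs_in P I d" if "G \<in> low_coeffs_in P I d" for F G
    using low_coeffs_in_mult[of F 0 G d] that by (simp add: low_coeffs_in_0)
qed

end

section \<open>Taylor expansion and Hasse derivatives\<close>

text \<open>
  \<open>taylor f\<close> is \<open>f(x + y)\<close> as a polynomial in \<open>y\<close> with coefficients in \<open>K[x]\<close>; its coefficient at
  the monomial \<open>y\<^sup>m\<close> is the Hasse derivative \<open>D\<^sup>m f\<close>.
\<close>

definition taylor :: "('v::finite, 'k::comm_ring_1) mpoly \<Rightarrow> ('v, ('v, 'k) mpoly) mpoly" where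
  "taylor = mpoly_eval (\<lambda>c. Const (Const c)) (\<lambda>i. Const (Var i) + Var i)"

lemma is_ring_hom_Const_Const: "is_ring_hom (\<lambda>c. Const (Const c))"
  by (rule is_ring_hom_comp[OF is_ring_hom_Const is_ring_hom_Const])

lemma is_ring_hom_taylor: "is_ring_hom taylor"
  unfolding taylor_def by (rule is_ring_hom_mpoly_eval[OF is_ring_hom_Const_Const])

lemmas taylor_add = hom_add[OF is_ring_hom_taylor]
  and taylor_mult = hom_mult[OF is_ring_hom_taylor]
  and taylor_zero = hom_zero[OF is_ring_hom_taylor]
  and taylor_diff = hom_diff[OF is_ring_hom_taylor]

lemma taylor_Const: "taylor (Const c) = Const (Const c)"
  by (simp add: taylor_def mpoly_eval_Const is_ring_hom_Const_Const)

lemma taylor_Var: "taylor (Var i) = Const (Var i) + Var i"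
  by (simp add: taylor_def mpoly_eval_Var is_ring_hom_Const_Const)

lemma is_ideal_singleton_zero: "is_ideal {0}"
  by (rule idealI) auto

abbreviation order_ge :: "nat \<Rightarrow> ('v::finite, 'a::comm_ring_1) mpoly set" where
  "order_ge \<equiv> low_coeffs_in {0} UNIV"

lemma is_ideal_order_ge: "is_ideal (order_ge d)"
  by (rule is_ideal_low_coeffs_in[OF is_ideal_singleton_zero])

lemma order_ge_subset_low_coeffs_in:
  "is_ideal P \<Longrightarrow> order_ge d \<subseteq> low_coeffs_in P I d"
  by (auto simp: low_coeffs_in_def ideal_zero)

lemma Var_order_ge_1: "Var i \<in> order_ge 1"
  by (auto simp: low_coeffs_in_def total_degree_eq_0_iff Var_def lookup_single when_def
      dest: arg_cong[where f = total_degree] simp: total_degree_single total_degree_zero)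

text \<open>Both terms agree at y = 0. For a product, the difference telescopes into multiples of
  the differences of the factors.\<close>

lemma taylor_minus_Const: "taylor f - Const f \<in> order_ge 1"
proof (induction f rule: mpoly_induct)
  case (Const c)
  show ?case
    by (simp add: taylor_Const ideal_zero[OF is_ideal_order_ge])
next
  case (Var i)
  show ?case
    using Var_order_ge_1 by (simp add: taylor_Var)
next
  case (add p q)
  have "taylor (p + q) - Const (p + q) = (taylor p - Const p) + (taylor q - Const q)"
    by (simp add: taylor_add hom_add[OF is_ring_hom_Const])
  then show ?case
    using add ideal_add[OF is_ideal_order_ge] by simp
next
  case (mult p q)
  have "taylor (p * q) - Const (p * q)
      = taylor q * (taylor p - Const p) + Const p * (taylor q - Const q)"
    by (simp add: taylor_mult hom_mult[OF is_ring_hom_Const] algebra_simps)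
  then show ?case
    using mult by (simp add: ideal_add[OF is_ideal_order_ge] ideal_mult[OF is_ideal_order_ge])
qed

lemma lookup_Const: "lookup (Const c) m = (c when m = 0)"
  by (auto simp: Const_def lookup_single when_def)

lemma lookup_taylor_0: "lookup (taylor f) 0 = f"
  using low_coeffs_inD[OF taylor_minus_Const[of f], of 0]
  by (simp add: total_degree_zero lookup_minus lookup_Const)

section \<open>Differential operators\<close>

lemma diff_ops_add:
  "\<delta> \<in> diff_ops scale d \<Longrightarrow> \<delta> (x + y) = \<delta> x + \<delta> y"
  by (cases d) (auto simp: module_hom_iff)

lemma diff_ops_zero:
  assumes "\<delta> \<in> diff_ops scale d"
  shows "\<delta> 0 = 0"
  using diff_ops_add[OF assms, of 0 0] by simp

lemma diff_ops_commutator: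
  "\<delta> \<in> diff_ops scale (Suc d) \<Longrightarrow> (\<lambda>f. \<delta> (g * f) - g * \<delta> f) \<in> diff_ops scale d"
  by simp

text \<open>In \<open>\<delta> (a * b) = a * \<delta> b + [\<delta>, a] b\<close> the first term is
  a multiple of \<open>a\<close>, and the commutator has order one less, which suits the lower power
  containing \<open>b\<close>.\<close>

lemma diff_op_ideal_power:
  assumes "is_ideal J" "\<delta> \<in> diff_ops scale d" "f \<in> ideal_power J (Suc d)"
  shows "\<delta> f \<in> J"
  using assms(2,3)
proof (induction d arbitrary: \<delta> f)
  case (0 \<delta> f)
  from 0(2) show ?case
  proof (induction rule: ideal_power_Suc_induct)
    case zero
    show ?case
      by (simp add: diff_ops_zero[OF 0(1)] ideal_zero[OF assms(1)])
  next
    case (step a b y)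
    have "\<delta> (a * b + y) = a * \<delta> b + \<delta> y"
      using 0(1) by (simp add: diff_ops_add[OF 0(1)]) (simp add: module_hom_iff)
    with step show ?case
      by (simp add: ideal_add[OF assms(1)] ideal_mult_right[OF assms(1)])
  qed
next
  case (Suc d \<delta> f)
  from Suc.prems(2) show ?case
  proof (induction rule: ideal_power_Suc_induct)
    case zero
    show ?case
      by (simp add: diff_ops_zero[OF Suc.prems(1)] ideal_zero[OF assms(1)])
  next
    case (step a b y)
    have "\<delta> (a * b + y) = a * \<delta> b + (\<delta> (a * b) - a * \<delta> b) + \<delta> y"
      by (simp add: diff_ops_add[OF Suc.prems(1)])
    moreover have "\<delta> (a * b) - a * \<delta> b \<in> J"
      using Suc.IH[OF diff_ops_commutator[OF Suc.prems(1), of a] step(2)] by simp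
    ultimately show ?case
      using step by (simp only: ideal_add[OF assms(1)] ideal_mult_right[OF assms(1)])
  qed
qed

text \<open>A local form of \<open>diff_op_ideal_power\<close>: \<open>s * \<delta> f\<close>
  differs from \<open>\<delta> (s * f)\<close> by a commutator, which the induction on the order
  handles, and \<open>s\<close> cancels modulo \<open>P\<close>.\<close>

lemma diff_op_mem_prime:
  assumes P: "prime_ideal P" and J: "is_ideal J" "J \<subseteq> P" and s: "s \<notin> P"
    and "\<delta> \<in> diff_ops scale d" "s * f \<in> ideal_power J (Suc d)"
  shows "\<delta> f \<in> P"
  using assms(5,6)
proof (induction d arbitrary: \<delta>)
  case 0
  have "\<delta> (s * f) \<in> P"
    using diff_op_ideal_power[OF J(1) 0] J(2) by blast
  moreover have "\<delta> (s * f) = s * \<delta> f"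
    using 0(1) by (simp add: module_hom_iff)
  ultimately show ?case
    using s prime_mult_iff[OF P] by simp
next
  case (Suc d)
  have "\<delta> (s * f) \<in> P"
    using diff_op_ideal_power[OF J(1) Suc.prems] J(2) by blast
  moreover have "\<delta> (s * f) - s * \<delta> f \<in> P"
    using Suc.IH[OF diff_ops_commutator[OF Suc.prems(1), of s]] Suc.prems(2)
      ideal_power_Suc_subset by blast
  ultimately have "\<delta> (s * f) - (\<delta> (s * f) - s * \<delta> f) \<in> P"
    by (rule ideal_diff[OF prime_is_ideal[OF P]])
  then have "s * \<delta> f \<in> P"
    by simp
  then show ?case
    using s prime_mult_iff[OF P] by simp
qed

text \<open>The first half of Zariski--Nagata: operators of order below \<open>n\<close> send
  \<open>f\<close> into every minimal prime, hence into their intersection \<open>J\<close>.\<close>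

lemma symbolic_power_subset_differential_power:
  assumes J: "radical_ideal J" and "n \<ge> 1"
  shows "symbolic_power J n \<subseteq> differential_power scale J n"
proof
  fix f assume f: "f \<in> symbolic_power J n"
  have idJ: "is_ideal J"
    using J by (simp add: radical_ideal_def)
  show "f \<in> differential_power scale J n"
    unfolding differential_power_def
  proof (intro CollectI ballI radical_ideal_minimal_primes[OF J])
    fix \<delta> P assume \<delta>: "\<delta> \<in> diff_ops scale (n - 1)" and P: "P \<in> minimal_primes J"
    obtain s where "s \<notin> P" "s * f \<in> ideal_power J (Suc (n - 1))"
      using f P \<open>n \<ge> 1\<close> by (auto simp: mem_symbolic_power_iff)
    moreover have "prime_ideal P" "J \<subseteq> P"
      using P by (auto simp: minimal_primes_def)
    ultimately show "\<delta> f \<in> P"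
      by (intro diff_op_mem_prime[OF _ idJ _ _ \<delta>])
  qed
qed

text \<open>The factor \<open>F\<close> makes the induction run: commuting with \<open>g\<close>
  replaces \<open>F\<close> by \<open>F * (taylor g - Const g)\<close>, whose order is one higher,
  so the excess of the degree of \<open>m\<close> over the order drops by one.\<close>

lemma hasse_diff_op_aux:
  fixes F :: "('v::finite, ('v, 'k::comm_ring_1) mpoly) mpoly"
  assumes "F \<in> order_ge k" "total_degree m \<le> k + d"
  shows "(\<lambda>f. lookup (F * taylor f) m) \<in> diff_ops mscale d"
  using assms
proof (induction d arbitrary: F k)
  case (0 F k)
  have "lookup (F * taylor (c * f)) m = c * lookup (F * taylor f) m" for c f
  proof -
    have "F * taylor (c * f) = taylor f * (F * (taylor c - Const c)) + Const c * (F * taylor f)"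
      by (simp add: taylor_mult algebra_simps)
    \<comment> \<open>The degree of \<open>m\<close> is at most \<open>k\<close> here, so a term of
      order \<open>k + 1\<close> has no coefficient at \<open>m\<close>.\<close>
    moreover have "taylor f * (F * (taylor c - Const c)) \<in> order_ge (k + 1)"
      using 0 taylor_minus_Const
      by (intro ideal_mult[OF is_ideal_order_ge] low_coeffs_in_mult[OF is_ideal_singleton_zero])
    then have "lookup (taylor f * (F * (taylor c - Const c))) m = 0"
      using low_coeffs_inD[of _ "{0}" UNIV "k + 1" m] 0 by simp
    ultimately show ?thesis
      by (simp add: lookup_add lookup_Const_mult)
  qed
  then show ?case
    by (simp add: module_hom_iff module_mult taylor_add distrib_left lookup_add)
next
  case (Suc d F k)
  have "lookup (F * taylor (mscale c f)) m = mscale c (lookup (F * taylor f) m)" for c f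
    using lookup_Const_mult[of "Const c" "F * taylor f" m]
    by (simp add: mscale_def taylor_mult taylor_Const mult_ac)
  moreover have "(\<lambda>f. lookup (F * taylor (g * f)) m - g * lookup (F * taylor f) m)
      \<in> diff_ops mscale d" for g
  proof -
    have "F * (taylor g - Const g) \<in> order_ge (k + 1)"
      using Suc.prems taylor_minus_Const by (intro low_coeffs_in_mult[OF is_ideal_singleton_zero])
    then have "(\<lambda>f. lookup (F * (taylor g - Const g) * taylor f) m) \<in> diff_ops mscale d"
      using Suc.prems by (intro Suc.IH[of _ "k + 1"]) auto
    moreover have "lookup (F * (taylor g - Const g) * taylor f) m
        = lookup (F * taylor (g * f)) m - g * lookup (F * taylor f) m" for f
      unfolding lookup_Const_mult[symmetric] lookup_minus[symmetric]
      by (simp add: taylor_mult algebra_simps)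
    ultimately show ?thesis
      by simp
  qed
  ultimately show ?case
    by (simp add: module_hom_iff module_mscale taylor_add distrib_left lookup_add)
qed

lemma hasse_diff_op:
  "total_degree m \<le> d \<Longrightarrow> (\<lambda>f. lookup (taylor f) m) \<in> diff_ops mscale d"
  using hasse_diff_op_aux[of 1 0 m d] by (simp add: low_coeffs_in_0)

lemma differential_power_taylor:
  fixes f :: "('v::finite, 'k::comm_ring_1) mpoly"
  assumes "f \<in> differential_power mscale J n"
  shows "taylor f \<in> low_coeffs_in J I n"
  unfolding low_coeffs_in_def
proof (intro CollectI allI impI)
  fix m :: "'v \<Rightarrow>\<^sub>0 nat" assume "total_degree m < n"
  then have "(\<lambda>f. lookup (taylor f) m) \<in> diff_ops mscale (n - 1)"
    by (intro hasse_diff_op) simp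
  moreover have "\<forall>\<delta>\<in>diff_ops mscale (n - 1). \<delta> f \<in> J"
    using assms by (simp add: differential_power_def)
  ultimately show "lookup (taylor f) m \<in> J"
    by (rule bspec[rotated])
qed

section \<open>Differential powers and the diagonal ideal\<close>

text \<open>Taylor's formula at the base point x' with increment x - x'. Both sides are ring
  homomorphisms, so constants and variables suffice.\<close>

lemma incl_S_eq_taylor:
  "incl_S f = mpoly_eval (rename_vars Inr) (\<lambda>i. Var (Inl i) - Var (Inr i))
     (taylor (f :: ('v::finite, 'k::comm_ring_1) mpoly))"
proof (rule ring_hom_mpoly_eq[where f = incl_S and g = "\<lambda>f. mpoly_eval (rename_vars Inr)
    (\<lambda>i. Var (Inl i) - Var (Inr i)) (taylor f)"])
  note hom = is_ring_hom_mpoly_eval[OF is_ring_hom_rename_vars]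
  show "is_ring_hom (incl_S :: ('v, 'k) mpoly \<Rightarrow> _)"
    unfolding incl_S_def by (rule is_ring_hom_rename_vars)
  show "is_ring_hom (\<lambda>f. mpoly_eval (rename_vars Inr) (\<lambda>i. Var (Inl i) - Var (Inr i))
     (taylor (f :: ('v, 'k) mpoly)))"
    by (rule is_ring_hom_comp[OF is_ring_hom_taylor hom])
  show "incl_S (Const c :: ('v, 'k) mpoly)
      = mpoly_eval (rename_vars Inr) (\<lambda>i. Var (Inl i) - Var (Inr i)) (taylor (Const c))" for c
    by (simp add: incl_S_def rename_vars_Const taylor_Const mpoly_eval_Const is_ring_hom_rename_vars)
  show "incl_S (Var i :: ('v, 'k) mpoly)
      = mpoly_eval (rename_vars Inr) (\<lambda>i. Var (Inl i) - Var (Inr i)) (taylor (Var i))" for i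
    by (simp add: incl_S_def rename_vars_Var taylor_Var hom_add[OF hom] mpoly_eval_Const
        mpoly_eval_Var is_ring_hom_rename_vars)
qed

lemma power_mult_mem_ideal_power:
  "a \<in> I \<Longrightarrow> b \<in> ideal_power I n \<Longrightarrow> a ^ k * b \<in> ideal_power I (k + n)"
  by (induction k) (simp_all add: ideal_power_SucI mult.assoc del: ideal_power.simps(2))

lemma prod_power_mem_ideal_power:
  "finite A \<Longrightarrow> (\<And>i. i \<in> A \<Longrightarrow> a i \<in> I) \<Longrightarrow> (\<Prod>i\<in>A. a i ^ e i) \<in> ideal_power I (sum e A)"
  by (induction A rule: finite_induct) (simp_all add: power_mult_mem_ideal_power)

lemma is_ideal_sum:
  assumes I: "is_ideal I" and J: "is_ideal J"
  shows "is_ideal (ideal_sum I J)"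
proof (rule idealI)
  have "0 = 0 + (0 :: 'a)"
    by simp
  then show "0 \<in> ideal_sum I J"
    unfolding ideal_sum_def using ideal_zero[OF I] ideal_zero[OF J] by blast
next
  fix x y assume "x \<in> ideal_sum I J" "y \<in> ideal_sum I J"
  then obtain a b a' b' where *: "x = a + b" "y = a' + b'" "a \<in> I" "a' \<in> I" "b \<in> J" "b' \<in> J"
    unfolding ideal_sum_def by blast
  then have "x + y = (a + a') + (b + b')"
    by (simp add: algebra_simps)
  then show "x + y \<in> ideal_sum I J"
    unfolding ideal_sum_def using * ideal_add[OF I] ideal_add[OF J] by blast
next
  fix c x assume "x \<in> ideal_sum I J"
  then obtain a b where *: "x = a + b" "a \<in> I" "b \<in> J"
    unfolding ideal_sum_def by blast
  then have "c * x = c * a + c * b"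
    by (simp add: algebra_simps)
  then show "c * x \<in> ideal_sum I J"
    unfolding ideal_sum_def using * ideal_mult[OF I] ideal_mult[OF J] by blast
qed

lemma ideal_sumI1: "is_ideal J \<Longrightarrow> a \<in> I \<Longrightarrow> a \<in> ideal_sum I J"
  unfolding ideal_sum_def by (intro CollectI exI[of _ a] exI[of _ 0]) (simp add: ideal_zero)

lemma ideal_sumI2: "is_ideal I \<Longrightarrow> a \<in> J \<Longrightarrow> a \<in> ideal_sum I J"
  unfolding ideal_sum_def by (intro CollectI exI[of _ 0] exI[of _ a]) (simp add: ideal_zero)

text \<open>The Taylor terms split by degree. Below \<open>n\<close> the coefficient is a Hasse
  derivative lying in \<open>J\<close>, so the term is in \<open>tilde J\<close>; from
  \<open>n\<close> on the monomial is in the power of \<open>Delta\<close>.\<close>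

lemma incl_S_mem_if_differential_power:
  fixes J :: "('v::finite, 'k::comm_ring_1) mpoly set"
  assumes "f \<in> differential_power mscale J n"
  shows "incl_S f \<in> ideal_sum (tilde J) (ideal_power Delta n)"
proof -
  let ?T = "ideal_sum (tilde J) (ideal_power Delta n)"
  have tilde: "is_ideal (tilde J)"
    by (simp add: tilde_def is_ideal_gen)
  have T: "is_ideal ?T"
    by (rule is_ideal_sum[OF tilde is_ideal_power])
  show ?thesis
    unfolding incl_S_eq_taylor mpoly_eval_def
  proof (rule ideal_sum_mem[OF T])
    fix m
    let ?y = "\<Prod>i\<in>UNIV. (Var (Inl i) - Var (Inr i)) ^ lookup m i :: ('v + 'v, 'k) mpoly"
    show "rename_vars Inr (lookup (taylor f) m) * ?y \<in> ?T"
    proof (cases "total_degree m < n")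
      case True
      then have "lookup (taylor f) m \<in> J"
        using low_coeffs_inD[OF differential_power_taylor[OF assms, of UNIV]] by simp
      then have "rename_vars Inr (lookup (taylor f) m) \<in> tilde J"
        by (simp add: tilde_def ideal_gen_base)
      then show ?thesis
        by (intro ideal_sumI1 is_ideal_power ideal_mult_right[OF tilde])
    next
      case False
      have "Var (Inl i) - Var (Inr i) \<in> (Delta :: ('v + 'v, 'k) mpoly set)" for i
        unfolding Delta_def by (rule ideal_gen_base) blast
      then have "?y \<in> ideal_power Delta (total_degree m)"
        unfolding total_degree_def by (intro prod_power_mem_ideal_power) auto
      then have "?y \<in> ideal_power Delta n"
        using False ideal_power_antimono[of n "total_degree m" Delta] by auto
      then show ?thesis
        by (intro ideal_sumI2 tilde ideal_mult[OF is_ideal_power])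
    qed
  qed
qed

text \<open>
  An element of \<open>T\<close> is read as a polynomial in \<open>x\<close> with coefficients in \<open>K[x']\<close>, the operator
  \<open>\<delta>\<close> is applied to the monomials in \<open>x\<close>, and \<open>x'\<close> is identified with \<open>x\<close>.
\<close>

definition pairing ::
    "(('v, 'k) mpoly \<Rightarrow> ('v, 'k) mpoly) \<Rightarrow> ('v::finite, ('v, 'k::comm_ring_1) mpoly) mpoly
       \<Rightarrow> ('v, 'k) mpoly" where
  "pairing \<delta> F = (\<Sum>m\<in>keys F. lookup F m * \<delta> (single m 1))"

lemma pairing_single: "pairing \<delta> (single m c) = c * \<delta> (single m 1)"
  by (simp add: pairing_def)

lemma pairing_add: "pairing \<delta> (F + G) = pairing \<delta> F + pairing \<delta> G"
  unfolding pairing_def by (rule setsum_keys_plus_distrib) (simp_all add: algebra_simps)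

lemma pairing_zero: "pairing \<delta> 0 = 0"
  by (simp add: pairing_def)

lemma pairing_Const_mult: "pairing \<delta> (Const c * F) = c * pairing \<delta> F"
  by (induction F rule: poly_mapping_single_induct)
    (simp_all add: Const_def mult_single pairing_single pairing_add distrib_left mult.assoc)

text \<open>Multiplying by \<open>Var i\<close> changes the argument of \<open>\<delta>\<close>,
  multiplying by \<open>Const (Var i)\<close> changes its result; the difference is the
  commutator.\<close>

lemma pairing_Var_minus_mult:
  "pairing \<delta> ((Var i - Const (Var i)) * F) = pairing (\<lambda>f. \<delta> (Var i * f) - Var i * \<delta> f) F"
proof -
  have "pairing \<delta> (Var i * F) = pairing (\<lambda>f. \<delta> (Var i * f)) F"
    by (induction F rule: poly_mapping_single_induct)
      (simp_all add: Var_def mult_single pairing_single pairing_add distrib_left)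
  moreover have "pairing (\<lambda>f. Var i * \<delta> f) F = Var i * pairing \<delta> F"
    by (simp add: pairing_def sum_distrib_left mult_ac)
  moreover have "pairing (\<lambda>f. \<delta> (Var i * f) - Var i * \<delta> f) F
      = pairing (\<lambda>f. \<delta> (Var i * f)) F - pairing (\<lambda>f. Var i * \<delta> f) F"
    by (simp add: pairing_def algebra_simps sum_subtractf)
  moreover have "pairing \<delta> (Var i * F)
      = pairing \<delta> ((Var i - Const (Var i)) * F) + pairing \<delta> (Const (Var i) * F)"
    by (simp flip: pairing_add add: algebra_simps)
  ultimately have "pairing \<delta> ((Var i - Const (Var i)) * F) + Var i * pairing \<delta> F
      = pairing (\<lambda>f. \<delta> (Var i * f) - Var i * \<delta> f) F + Var i * pairing \<delta> F"
    by (simp add: pairing_Const_mult)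
  then show ?thesis
    by simp
qed

text \<open>Reads \<open>T\<close> as K[x'][x]. The coefficient ring has the type of
  \<open>S\<close> itself, so \<open>pairing\<close> identifies x' with x without a further
  map.\<close>

definition split_vars :: "('v + 'v, 'k::comm_ring_1) mpoly \<Rightarrow> ('v::finite, ('v, 'k) mpoly) mpoly"
  where "split_vars = mpoly_eval (\<lambda>c. Const (Const c)) (case_sum Var (\<lambda>i. Const (Var i)))"

lemma is_ring_hom_split_vars: "is_ring_hom split_vars"
  unfolding split_vars_def by (rule is_ring_hom_mpoly_eval[OF is_ring_hom_Const_Const])

lemmas split_vars_add = hom_add[OF is_ring_hom_split_vars]
  and split_vars_mult = hom_mult[OF is_ring_hom_split_vars]
  and split_vars_diff = hom_diff[OF is_ring_hom_split_vars]
  and split_vars_zero = hom_zero[OF is_ring_hom_split_vars]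

lemma split_vars_Const: "split_vars (Const c) = Const (Const c)"
  by (simp add: split_vars_def mpoly_eval_Const is_ring_hom_Const_Const)

lemma split_vars_Inl: "split_vars (Var (Inl i)) = Var i"
  and split_vars_Inr: "split_vars (Var (Inr i)) = Const (Var i)"
  by (simp_all add: split_vars_def mpoly_eval_Var is_ring_hom_Const_Const)

lemma split_vars_rename_Inr: "split_vars (rename_vars Inr g) = Const g"
  by (rule ring_hom_mpoly_eq)
    (simp_all add: is_ring_hom_comp[OF is_ring_hom_rename_vars is_ring_hom_split_vars]
      is_ring_hom_Const rename_vars_Const rename_vars_Var split_vars_Const split_vars_Inr)

lemma split_vars_incl_S: "split_vars (incl_S f) = mpoly_eval (\<lambda>c. Const (Const c)) Var f"
  unfolding incl_S_def
  by (rule ring_hom_mpoly_eq)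
    (simp_all add: is_ring_hom_comp[OF is_ring_hom_rename_vars is_ring_hom_split_vars]
      is_ring_hom_mpoly_eval is_ring_hom_Const_Const rename_vars_Const rename_vars_Var
      split_vars_Const split_vars_Inl mpoly_eval_Const mpoly_eval_Var)

lemma diff_ops_scale:
  fixes \<delta> :: "('v, 'k::comm_ring_1) mpoly \<Rightarrow> ('v, 'k) mpoly"
  shows "\<delta> \<in> diff_ops mscale d \<Longrightarrow> \<delta> (mscale c f) = mscale c (\<delta> f)"
  by (cases d) (simp_all add: module_hom_iff mscale_def)

text \<open>An element of \<open>S\<close> has scalar coefficients after splitting, so linearity
  over K recovers \<open>\<delta> f\<close> from its values on monomials.\<close>

lemma pairing_incl_S:
  assumes "\<delta> \<in> diff_ops mscale d"
  shows "pairing \<delta> (split_vars (incl_S f)) = \<delta> f"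
  unfolding split_vars_incl_S
proof (induction f rule: poly_mapping_single_induct)
  case (single m c)
  have "pairing \<delta> (mpoly_eval (\<lambda>c. Const (Const c)) Var (single m c))
      = Const c * \<delta> (single m 1)"
    by (simp add: mpoly_eval_single is_ring_hom_Const_Const pairing_Const_mult
        single_eq_Const_mult_Var[of m 1, symmetric] pairing_single Const_def[of 1]
        Var_power prod_single sum_single_lookup_UNIV)
  also have "\<dots> = \<delta> (single m c)"
    using diff_ops_scale[OF assms, of c "single m 1"]
    by (simp add: mscale_def Const_def mult_single)
  finally show ?case .
next
  case (add p q)
  then show ?case
    by (simp add: mpoly_eval_add is_ring_hom_Const_Const pairing_add diff_ops_add[OF assms])
qed

text \<open>\<open>pairing\<close> is linear over the coefficient ring, where the generators of
  \<open>tilde J\<close> become the elements of \<open>J\<close> themselves.\<close>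

lemma pairing_tilde:
  assumes J: "is_ideal J" and "t \<in> tilde J"
  shows "pairing \<delta> (split_vars t) \<in> J"
  using assms(2) unfolding tilde_def
proof (induction rule: ideal_gen_induct)
  case zero
  show ?case
    by (simp add: split_vars_zero pairing_zero ideal_zero[OF J])
next
  case (step c b y)
  then obtain j where j: "b = rename_vars Inr j" "j \<in> J"
    by blast
  then have "pairing \<delta> (split_vars (c * b + y))
      = j * pairing \<delta> (split_vars c) + pairing \<delta> (split_vars y)"
    by (simp add: split_vars_add split_vars_mult split_vars_rename_Inr pairing_add
        pairing_Const_mult mult.commute[of _ "Const j"])
  with step j show ?case
    by (simp add: ideal_add[OF J] ideal_mult_right[OF J])
qed

text \<open>One factor from \<open>Delta\<close> is traded for one commutator of
  \<open>\<delta>\<close> with a variable.\<close>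

lemma pairing_Delta_power_step:
  fixes \<delta> :: "('v::finite, 'k::comm_ring_1) mpoly \<Rightarrow> ('v, 'k) mpoly"
  assumes IH: "\<And>i t. t \<in> ideal_power Delta d \<Longrightarrow>
      pairing (\<lambda>f. \<delta> (Var i * f) - Var i * \<delta> f) (split_vars t) = 0"
    and "t \<in> ideal_power Delta (Suc d)"
  shows "pairing \<delta> (split_vars t) = 0"
proof -
  have *: "pairing \<delta> (split_vars (a * b)) = 0" if "a \<in> Delta" "b \<in> ideal_power Delta d" for a b
    using that(1) unfolding Delta_def
  proof (induction rule: ideal_gen_induct)
    case zero
    show ?case
      by (simp add: split_vars_zero pairing_zero)
  next
    case (step c g y)
    then obtain i where g: "g = Var (Inl i) - Var (Inr i)"
      by blast
    have "split_vars (c * g * b) = (Var i - Const (Var i)) * split_vars (c * b)"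
      by (simp add: g split_vars_mult split_vars_diff split_vars_Inl split_vars_Inr mult_ac)
    then have "pairing \<delta> (split_vars (c * g * b)) = 0"
      using IH[OF ideal_mult[OF is_ideal_power that(2)]] by (simp add: pairing_Var_minus_mult)
    with step show ?case
      by (simp add: distrib_right split_vars_add pairing_add)
  qed
  from assms(2) show ?thesis
    by (induction rule: ideal_power_Suc_induct)
      (simp_all add: split_vars_zero pairing_zero split_vars_add pairing_add *)
qed

lemma pairing_Delta_power:
  fixes \<delta> :: "('v::finite, 'k::comm_ring_1) mpoly \<Rightarrow> ('v, 'k) mpoly"
  assumes "\<delta> \<in> diff_ops mscale d" "t \<in> ideal_power Delta (Suc d)"
  shows "pairing \<delta> (split_vars t) = 0"
  using assms
proof (induction d arbitrary: \<delta> t)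
  case (0 \<delta> t)
  have commutator: "(\<lambda>f. \<delta> (Var i * f) - Var i * \<delta> f) = (\<lambda>_. 0)" for i
    using 0(1) by (simp add: module_hom_iff)
  show ?case
    by (rule pairing_Delta_power_step[OF _ 0(2)]) (simp only: commutator, simp add: pairing_def)
next
  case (Suc d \<delta> t)
  show ?case
    by (rule pairing_Delta_power_step[OF _ Suc.prems(2)])
      (rule Suc.IH[OF diff_ops_commutator[OF Suc.prems(1)]])
qed

lemma differential_power_if_incl_S_mem:
  fixes J :: "('v::finite, 'k::comm_ring_1) mpoly set"
  assumes J: "is_ideal J" and "n \<ge> 1"
    and "incl_S f \<in> ideal_sum (tilde J) (ideal_power Delta n)"
  shows "f \<in> differential_power mscale J n"
  unfolding differential_power_def
proof (intro CollectI ballI)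
  fix \<delta> :: "('v, 'k) mpoly \<Rightarrow> ('v, 'k) mpoly"
  assume \<delta>: "\<delta> \<in> diff_ops mscale (n - 1)"
  \<comment> \<open>As \<open>n \<ge> 1\<close>, the exponent equals \<open>Suc (n - 1)\<close>,
    just enough to be killed by operators of order \<open>n - 1\<close>.\<close>
  obtain a b where ab: "incl_S f = a + b" "a \<in> tilde J" "b \<in> ideal_power Delta (Suc (n - 1))"
    using assms(2,3) by (auto simp: ideal_sum_def)
  have "\<delta> f = pairing \<delta> (split_vars a) + pairing \<delta> (split_vars b)"
    by (simp add: pairing_incl_S[OF \<delta>, symmetric] ab(1) split_vars_add pairing_add)
  then show "\<delta> f \<in> J"
    using pairing_tilde[OF J ab(2), of \<delta>] pairing_Delta_power[OF \<delta> ab(3)] by simp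
qed

lemma differential_power_eq_diagonal:
  fixes J :: "('v::finite, 'k::comm_ring_1) mpoly set"
  assumes "is_ideal J" "n \<ge> 1"
  shows "incl_S ` differential_power mscale J n
    = ideal_sum (tilde J) (ideal_power Delta n) \<inter> range incl_S"
  using incl_S_mem_if_differential_power differential_power_if_incl_S_mem[OF assms] by blast

section \<open>Partial derivatives\<close>

text \<open>Taken as a first Hasse derivative, so that facts about Taylor expansions and operators
  of order one apply directly.\<close>

definition partial :: "'v \<Rightarrow> ('v::finite, 'k::comm_ring_1) mpoly \<Rightarrow> ('v, 'k) mpoly" where
  "partial i f = lookup (taylor f) (single i 1)"

lemma partial_add: "partial i (f + g) = partial i f + partial i g"
  by (simp add: partial_def taylor_add lookup_add)

lemma partial_zero: "partial i 0 = 0"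
  by (simp add: partial_def taylor_zero)

lemma partial_Const: "partial i (Const c) = 0"
  by (simp add: partial_def taylor_Const lookup_Const when_def flip: total_degree_eq_0_iff)
    (simp add: total_degree_single)

lemma partial_Var:
  "partial i (Var j :: ('a::finite, 'b::comm_ring_1) mpoly) = (if i = j then 1 else 0)"
proof -
  have "single i (1::nat) \<noteq> 0"
    using total_degree_single[of i 1] by (auto simp: total_degree_zero)
  moreover have "single j (1::nat) = single i 1 \<longleftrightarrow> i = j"
    by (metis lookup_single_eq lookup_single_not_eq one_neq_zero)
  ultimately have "lookup (Const (Var j) :: ('a, ('a, 'b) mpoly) mpoly) (single i 1) = 0"
    "lookup (Var j :: ('a, ('a, 'b) mpoly) mpoly) (single i 1) = (if i = j then 1 else 0)"
    by (simp_all add: lookup_Const Var_def lookup_single when_def)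
  then show ?thesis
    by (simp add: partial_def taylor_Var lookup_add)
qed

text \<open>The product of \<open>taylor f - Const f\<close> and \<open>taylor g - Const g\<close>
  has order at least 2; the Leibniz rule says that its linear coefficients vanish.\<close>

lemma partial_mult: "partial i (f * g) = f * partial i g + partial i f * g"
proof -
  have "(taylor f - Const f) * (taylor g - Const g) \<in> order_ge (1 + 1)"
    by (intro low_coeffs_in_mult[OF is_ideal_singleton_zero] taylor_minus_Const)
  then have "lookup ((taylor f - Const f) * (taylor g - Const g)) (single i 1) = 0"
    using low_coeffs_inD[of _ "{0}" UNIV "1 + 1" "single i 1"] by (simp add: total_degree_single)
  moreover have "(taylor f - Const f) * (taylor g - Const g)
      = taylor (f * g) - Const f * taylor g - Const g * taylor f + Const f * Const g"
    by (simp add: taylor_mult algebra_simps)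
  moreover have "lookup (Const f * Const g) (single i 1) = 0"
    using partial_Const[of i] total_degree_single[of i 1]
    by (auto simp: lookup_Const_mult lookup_Const when_def total_degree_zero)
  ultimately have "partial i (f * g) - f * partial i g - g * partial i f = 0"
    by (simp only: partial_def lookup_minus lookup_add lookup_Const_mult add_0_right)
  then show ?thesis
    by (simp add: algebra_simps)
qed

lemma partial_power: "partial i (f ^ n) = of_nat n * f ^ (n - 1) * partial i f"
proof (induction n)
  case 0
  then show ?case
    using partial_Const[of i 1] by (simp add: Const_def)
next
  case (Suc n)
  then show ?case
    by (cases n) (simp_all add: partial_mult algebra_simps)
qed

lemma partial_mem_of_square:
  assumes "is_ideal P" "w \<in> ideal_power P 2"
  shows "partial i w \<in> P"
proof -
  have "(\<lambda>f. lookup (taylor f) (single i 1)) \<in> diff_ops mscale 1"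
    by (rule hasse_diff_op) (simp add: total_degree_single)
  from diff_op_ideal_power[OF assms(1) this, of w] assms(2) show ?thesis
    by (simp add: partial_def numeral_2_eq_2)
qed

lemma partial_diff: "partial i (f - g) = partial i f - partial i g"
  using partial_add[of i "f - g" g] by simp

lemma partial_poly:
  "partial i (poly F x) = poly (map_poly (partial i) F) x + poly (pderiv F) x * partial i x"
  by (induction F)
    (simp_all add: partial_zero partial_add partial_mult map_poly_pCons pderiv_pCons algebra_simps)

section \<open>Polynomials over a subset of a ring\<close>

definition polys_over :: "'a::comm_ring_1 set \<Rightarrow> 'a poly set" where
  "polys_over R = {F. \<forall>n. coeff F n \<in> R}"

lemma polys_overD: "F \<in> polys_over R \<Longrightarrow> coeff F n \<in> R"
  by (simp add: polys_over_def)

text \<open>For a subring \<open>R\<close> and an ideal \<open>P\<close>: the residues of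
  \<open>1, x, ..., x ^ (e - 1)\<close> modulo \<open>P\<close> are linearly independent over the
  image of \<open>R\<close>.\<close>

definition independent_powers :: "'a::comm_ring_1 set \<Rightarrow> 'a set \<Rightarrow> 'a \<Rightarrow> nat \<Rightarrow> bool" where
  "independent_powers R P x e \<longleftrightarrow>
     (\<forall>G\<in>polys_over R. (\<forall>n\<ge>e. coeff G n = 0) \<longrightarrow> poly G x \<in> P \<longrightarrow> (\<forall>n. coeff G n \<in> P))"

lemma independent_powersD:
  "independent_powers R P x e \<Longrightarrow> G \<in> polys_over R \<Longrightarrow> (\<And>n. n \<ge> e \<Longrightarrow> coeff G n = 0) \<Longrightarrow>
     poly G x \<in> P \<Longrightarrow> coeff G n \<in> P"
  unfolding independent_powers_def by blast

lemma independent_powers_antimono: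
  "independent_powers R P x e \<Longrightarrow> d \<le> e \<Longrightarrow> independent_powers R P x d"
  unfolding independent_powers_def using order_trans by blast

lemma poly_mem_ideal:
  assumes "is_ideal I" "\<And>n. s * coeff G n \<in> I"
  shows "s * poly G x \<in> I"
proof -
  have "s * poly G x = (\<Sum>n\<le>degree G. s * coeff G n * x ^ n)"
    by (simp add: poly_altdef sum_distrib_left mult.assoc)
  also have "\<dots> \<in> I"
    by (intro ideal_sum_mem[OF assms(1)] ideal_mult_right[OF assms(1)] assms(2))
  finally show ?thesis .
qed

section \<open>Adjoining an element and dividing with remainder\<close>

definition is_subring :: "'a::comm_ring_1 set \<Rightarrow> bool" where
  "is_subring R \<longleftrightarrow> - 1 \<in> R \<and> (\<forall>a\<in>R. \<forall>b\<in>R. a + b \<in> R \<and> a * b \<in> R)"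

context
  fixes R :: "'a::comm_ring_1 set"
  assumes R: "is_subring R"
begin

lemma subring_add: "a \<in> R \<Longrightarrow> b \<in> R \<Longrightarrow> a + b \<in> R"
  and subring_mult: "a \<in> R \<Longrightarrow> b \<in> R \<Longrightarrow> a * b \<in> R"
  using R by (auto simp: is_subring_def)

lemma subring_uminus: "a \<in> R \<Longrightarrow> - a \<in> R"
  using R by (metis is_subring_def mult_minus1)

lemma subring_one: "1 \<in> R"
  using R subring_uminus[of "- 1"] by (simp add: is_subring_def)

lemma subring_zero: "0 \<in> R"
  using subring_add[of 1 "- 1"] subring_one subring_uminus by simp

lemma subring_diff: "a \<in> R \<Longrightarrow> b \<in> R \<Longrightarrow> a - b \<in> R"
  using subring_add[of a "- b"] subring_uminus[of b] by simp

lemma subring_of_nat: "of_nat n \<in> R"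
  by (induction n) (simp_all add: subring_zero subring_one subring_add)

lemma subring_sum: "(\<And>a. a \<in> A \<Longrightarrow> f a \<in> R) \<Longrightarrow> sum f A \<in> R"
  by (induction A rule: infinite_finite_induct) (auto intro: subring_zero subring_add)

lemma is_subring_adjoin: "is_subring ((\<lambda>F. poly F x) ` polys_over R)"
proof -
  have "[:- 1:] \<in> polys_over R"
    by (auto simp: polys_over_def coeff_pCons subring_zero subring_uminus subring_one
        split: nat.split)
  then have "- 1 \<in> (\<lambda>F. poly F x) ` polys_over R"
    by (rule rev_image_eqI) simp
  moreover have "poly F x + poly G x \<in> (\<lambda>F. poly F x) ` polys_over R"
    "poly F x * poly G x \<in> (\<lambda>F. poly F x) ` polys_over R"
    if "F \<in> polys_over R" "G \<in> polys_over R" for F G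
  proof -
    have "F + G \<in> polys_over R" "F * G \<in> polys_over R"
      using that
      by (auto simp: polys_over_def coeff_mult intro!: subring_add subring_mult subring_sum)
    then have "poly (F + G) x \<in> (\<lambda>F. poly F x) ` polys_over R"
      "poly (F * G) x \<in> (\<lambda>F. poly F x) ` polys_over R"
      by blast+
    then show "poly F x + poly G x \<in> (\<lambda>F. poly F x) ` polys_over R"
      "poly F x * poly G x \<in> (\<lambda>F. poly F x) ` polys_over R"
      by simp_all
  qed
  ultimately show ?thesis
    by (auto simp: is_subring_def)
qed

lemma subring_subset_adjoin: "a \<in> R \<Longrightarrow> a \<in> (\<lambda>F. poly F x) ` polys_over R"
  by (rule rev_image_eqI[of "[:a:]"])
    (auto simp: polys_over_def coeff_pCons subring_zero split: nat.split)

lemma mem_adjoin: "x \<in> (\<lambda>F. poly F x) ` polys_over R"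
  by (rule rev_image_eqI[of "[:0, 1:]"])
    (auto simp: polys_over_def coeff_pCons subring_zero subring_one split: nat.split)

text \<open>Instead of dividing by the leading coefficient of \<open>h\<close>, each elimination
  multiplies \<open>F\<close> by it. The induction is on the degree bound \<open>d\<close>.\<close>

lemma pseudo_division:
  assumes h: "h \<in> polys_over R" and F: "F \<in> polys_over R" "\<And>n. n \<ge> d \<Longrightarrow> coeff F n = 0"
  shows "\<exists>N Q G. smult (lead_coeff h ^ N) F = Q * h + G \<and> G \<in> polys_over R \<and>
    (\<forall>n\<ge>degree h. coeff G n = 0)"
  using F
proof (induction d arbitrary: F)
  case 0
  then show ?case
    by (intro exI[of _ 0] exI[of _ F]) auto
next
  case (Suc d)
  let ?r = "lead_coeff h"
  show ?case
  proof (cases "d < degree h")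
    case True
    then show ?thesis
      using Suc.prems by (intro exI[of _ 0] exI[of _ F]) auto
  next
    case False
    define M where "M = monom (coeff F d) (d - degree h)"
    define F' where "F' = smult ?r F - M * h"
    have coeff: "coeff F' n = ?r * coeff F n
        - (if n < d - degree h then 0 else coeff F d * coeff h (n - (d - degree h)))" for n
      by (simp add: F'_def M_def coeff_monom_mult)
    have "coeff F' n = 0" if "n \<ge> d" for n
    proof (cases "n = d")
      case True
      with False show ?thesis
        by (simp add: coeff mult.commute)
    next
      case False': False
      have "coeff h (n - (d - degree h)) = 0"
        using that False' False by (intro coeff_eq_0) simp
      then show ?thesis
        using that False' Suc.prems(2)[of n] by (simp add: coeff)
    qed
    moreover have "F' \<in> polys_over R"
      using h Suc.prems(1)
      by (auto simp: polys_over_def coeff intro!: subring_diff subring_mult subring_zero)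
    ultimately obtain N Q G where IH: "smult (?r ^ N) F' = Q * h + G" "G \<in> polys_over R"
      "\<forall>n\<ge>degree h. coeff G n = 0"
      using Suc.IH[of F'] by blast
    have "smult (?r ^ Suc N) F = smult (?r ^ N) (smult ?r F)"
      by (simp add: mult.commute)
    also have "smult ?r F = F' + M * h"
      by (simp add: F'_def)
    finally have "smult (?r ^ Suc N) F = (Q + smult (?r ^ N) M) * h + G"
      by (simp add: smult_add_right IH(1) algebra_simps)
    with IH(2,3) show ?thesis
      by blast
  qed
qed

end

lemma pderiv_polys_over:
  fixes R :: "'a::idom set"
  shows "is_subring R \<Longrightarrow> F \<in> polys_over R \<Longrightarrow> pderiv F \<in> polys_over R"
  by (simp add: polys_over_def coeff_pderiv subring_mult subring_of_nat del: of_nat_Suc)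

section \<open>Vanishing derivatives and the square of a prime\<close>

text \<open>The rings of the induction, with the variables in \<open>A\<close> adjoined. Vanishing
  of the other derivatives makes \<open>R\<close> constant for the next variable
  \<open>Var k\<close>; in characteristic p the p-th powers make \<open>Var k\<close> a root of
  \<open>t ^ p - Var k ^ p\<close>, a polynomial over \<open>R\<close>.\<close>

definition diff_subring :: "'v::{finite,linorder} set \<Rightarrow> ('v, 'k::field) mpoly set \<Rightarrow> bool" where
  "diff_subring A R \<longleftrightarrow> is_subring R \<and> range Const \<subseteq> R \<and> Var ` A \<subseteq> R \<and>
     (\<forall>i. \<forall>f\<in>R. partial i f \<in> R) \<and> (\<forall>i. i \<notin> A \<longrightarrow> (\<forall>f\<in>R. partial i f = 0)) \<and>
     (CHAR('k) \<noteq> 0 \<longrightarrow> (\<forall>f. f ^ CHAR('k) \<in> R))"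

definition detects_square :: "('v::{finite,linorder}, 'k::field) mpoly set \<Rightarrow> ('v, 'k) mpoly set \<Rightarrow> bool" where
  "detects_square P R \<longleftrightarrow>
     (\<forall>f\<in>R. f \<in> P \<longrightarrow> (\<forall>i. partial i f \<in> P) \<longrightarrow> (\<exists>s. s \<notin> P \<and> s * f \<in> ideal_power P 2))"

lemma diff_subring_adjoin:
  fixes R :: "('v::{finite,linorder}, 'k::field) mpoly set"
  assumes "diff_subring A R"
  shows "diff_subring (insert k A) ((\<lambda>F. poly F (Var k)) ` polys_over R)"
proof -
  let ?R = "(\<lambda>F. poly F (Var k)) ` polys_over R"
  have R: "is_subring R" and d: "\<And>i f. f \<in> R \<Longrightarrow> partial i f \<in> R"
    and d0: "\<And>i f. i \<notin> A \<Longrightarrow> f \<in> R \<Longrightarrow> partial i f = 0"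
    using assms by (auto simp: diff_subring_def)
  have R': "is_subring ?R"
    by (rule is_subring_adjoin[OF R])
  note sub = subring_subset_adjoin[OF R, of _ "Var k"]
  have map_d: "map_poly (partial i) F \<in> polys_over R" if "F \<in> polys_over R" for i F
    using that d by (auto simp: polys_over_def coeff_map_poly partial_zero)
  have "partial i f \<in> ?R" if f: "f \<in> ?R" for i f
  proof -
    obtain F where F: "f = poly F (Var k)" "F \<in> polys_over R"
      using f by blast
    have "partial i (Var k :: ('v, 'k) mpoly) \<in> ?R"
      by (simp add: partial_Var subring_zero[OF R'] subring_one[OF R'])
    then show ?thesis
      unfolding F(1) partial_poly
      by (intro subring_add[OF R'] subring_mult[OF R'] imageI map_d F pderiv_polys_over[OF R])
  qed
  moreover have "partial i f = 0" if i: "i \<notin> insert k A" and f: "f \<in> ?R" for i f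
  proof -
    obtain F where F: "f = poly F (Var k)" "F \<in> polys_over R"
      using f by blast
    have "map_poly (partial i) F = 0"
      using F(2) d0 i by (intro poly_eqI) (simp add: coeff_map_poly partial_zero polys_over_def)
    then show ?thesis
      using i by (simp add: F(1) partial_poly partial_Var)
  qed
  moreover have "range Const \<subseteq> ?R"
    using assms by (intro subsetI sub) (auto simp: diff_subring_def)
  moreover have "Var ` A \<subseteq> ?R"
    using assms by (intro subsetI sub) (auto simp: diff_subring_def)
  then have "Var ` insert k A \<subseteq> ?R"
    using mem_adjoin[OF R, of "Var k"] by simp
  moreover have "f ^ CHAR('k) \<in> ?R" if "CHAR('k) \<noteq> 0" for f
    using assms that by (intro sub) (simp add: diff_subring_def)
  ultimately show ?thesis
    using R' unfolding diff_subring_def by metis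
qed

lemma Const_not_mem_prime:
  fixes c :: "'k::field"
  assumes P: "prime_ideal P" and "c \<noteq> 0"
  shows "Const c \<notin> P"
proof
  assume "Const c \<in> P"
  then have "Const (inverse c) * Const c \<in> P"
    by (rule ideal_mult[OF prime_is_ideal[OF P]])
  then show False
    using assms prime_one[OF P] by (simp add: hom_mult[OF is_ring_hom_Const, symmetric]
        hom_one[OF is_ring_hom_Const])
qed

lemma of_nat_mpoly: "of_nat n = (Const (of_nat n) :: ('v, 'k::comm_ring_1) mpoly)"
  by (simp add: Const_def)

text \<open>If a relation for \<open>Var k\<close> modulo \<open>P\<close> exists, \<open>F\<close>
  is divided by one of least degree \<open>e\<close>, and differentiation shows that the quotient is
  in \<open>P\<close>, so only an element of the square is lost. If \<open>e\<close> vanishes in the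
  field, exact division by the p-th power relation is used instead.\<close>

lemma reduce_modulo_square:
  fixes P R :: "('v::{finite,linorder}, 'k::field) mpoly set"
  assumes P: "prime_ideal P" and DR: "diff_subring A R" and "k \<notin> A"
    and F: "F \<in> polys_over R" "poly F (Var k) \<in> P"
    and dF: "\<And>i. partial i (poly F (Var k)) \<in> P"
  shows "\<exists>e t G. t \<notin> P \<and> t * poly F (Var k) - poly G (Var k) \<in> ideal_power P 2 \<and>
    G \<in> polys_over R \<and> (\<forall>n\<ge>e. coeff G n = 0) \<and> independent_powers R P (Var k) e"
proof -
  let ?x = "Var k :: ('v, 'k) mpoly"
  let ?indep = "independent_powers R P ?x"
  have R: "is_subring R"
    and d0: "\<And>f. f \<in> R \<Longrightarrow> partial k f = 0"
    using DR \<open>k \<notin> A\<close> by (auto simp: diff_subring_def)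
  note idP = prime_is_ideal[OF P]
  have partial_k: "partial k (poly G ?x) = poly (pderiv G) ?x" if "G \<in> polys_over R" for G
  proof -
    have "map_poly (partial k) G = 0"
      using that d0 by (intro poly_eqI) (simp add: coeff_map_poly partial_zero polys_over_def)
    then show ?thesis
      by (simp add: partial_poly partial_Var)
  qed
  show ?thesis
  proof (cases "\<forall>e. ?indep e")
    \<comment> \<open>No relation exists, so \<open>F\<close> itself serves, with a bound beyond its
      degree.\<close>
    case True
    then show ?thesis
      using F(1) prime_one[OF P] coeff_eq_0[of F] ideal_zero[OF is_ideal_power]
      by (intro exI[of _ "Suc (degree F)"] exI[of _ 1] exI[of _ F]) auto
  next
    case False
    \<comment> \<open>The least degree of a relation: the powers below \<open>e\<close> are
      independent, but no longer with \<open>x ^ e\<close> included.\<close>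
    define e where "e = (LEAST e. \<not> ?indep (Suc e))"
    have zero: "?indep 0"
      by (auto simp: independent_powers_def ideal_zero[OF idP])
    with False have "\<exists>e. \<not> ?indep (Suc e)"
      by (metis not0_implies_Suc)
    then have not_indep: "\<not> ?indep (Suc e)"
      unfolding e_def by (rule LeastI_ex)
    have indep: "?indep e"
    proof (cases e)
      case (Suc e')
      then show ?thesis
        using not_less_Least[of e' "\<lambda>e. \<not> ?indep (Suc e)"] by (auto simp flip: e_def)
    qed (use zero in simp)
    obtain H m where H: "H \<in> polys_over R" "\<And>n. n \<ge> Suc e \<Longrightarrow> coeff H n = 0"
      "poly H ?x \<in> P" "coeff H m \<notin> P"
      using not_indep unfolding independent_powers_def by blast
    \<comment> \<open>Otherwise dropping the term of degree \<open>e\<close> leaves a relation among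
      independent powers, which puts every coefficient of \<open>H\<close> in
      \<open>P\<close>.\<close>
    have lead: "coeff H e \<notin> P"
    proof
      assume e: "coeff H e \<in> P"
      let ?H = "H - monom (coeff H e) e"
      have "?H \<in> polys_over R"
        using H(1) by (auto simp: polys_over_def intro!: subring_diff[OF R] subring_zero[OF R])
      moreover have "coeff ?H n = 0" if "n \<ge> e" for n
        using H(2)[of n] that by (cases "n = e") auto
      moreover have "poly ?H ?x \<in> P"
        using H(3) e by (simp add: poly_monom ideal_diff[OF idP] ideal_mult_right[OF idP])
      ultimately have "coeff ?H m \<in> P"
        by (rule independent_powersD[OF indep])
      with H(4) e show False
        by (cases "m = e") auto
    qed
    then have "coeff H e \<noteq> 0"
      using ideal_zero[OF idP] by metis
    then have deg: "degree H = e"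
      using H(2) by (intro antisym le_degree degree_le) auto
    show ?thesis
    proof (cases "of_nat e = (0 :: 'k)")
      case False': False
      obtain N Q G where QG: "smult (lead_coeff H ^ N) F = Q * H + G" "G \<in> polys_over R"
        "\<forall>n\<ge>e. coeff G n = 0"
        using pseudo_division[OF R H(1) F(1), of "Suc (degree F)"] coeff_eq_0[of F]
        unfolding deg by fastforce
      let ?t = "lead_coeff H ^ N" and ?q = "poly Q ?x" and ?h = "poly H ?x" and ?g = "poly G ?x"
      have eq: "?t * poly F ?x = ?q * ?h + ?g"
        using arg_cong[OF QG(1), of "\<lambda>p. poly p ?x"] by simp
      have "?t * poly F ?x - ?q * ?h \<in> P"
        using F(2) H(3) by (intro ideal_diff[OF idP] ideal_mult[OF idP])
      then have g: "?g \<in> P"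
        by (simp add: eq)
      have G_P: "coeff G n \<in> P" for n
        using independent_powersD[OF indep QG(2) _ g] QG(3) by blast
      then have "coeff (pderiv G) n \<in> P" for n
        unfolding coeff_pderiv by (intro ideal_mult[OF idP])
      then have dg: "partial k ?g \<in> P"
        using poly_mem_ideal[OF idP, of 1 "pderiv G" ?x] by (simp add: partial_k[OF QG(2)])
      \<comment> \<open>The derivative of \<open>H\<close> has degree below \<open>e\<close>. If its
        value were in \<open>P\<close>, independence would put \<open>e\<close> times the leading
        coefficient of \<open>H\<close> in \<open>P\<close>, although \<open>e\<close> is a
        unit.\<close>
      have dh: "partial k ?h \<notin> P"
      proof
        assume "partial k ?h \<in> P"
        then have "poly (pderiv H) ?x \<in> P"
          by (simp add: partial_k[OF H(1)])
        moreover have "coeff (pderiv H) n = 0" if "n \<ge> e" for n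
          using H(2)[of "Suc n"] that by (simp add: coeff_pderiv)
        ultimately have "coeff (pderiv H) (e - 1) \<in> P"
          using independent_powersD[OF indep pderiv_polys_over[OF R H(1)]] by blast
        moreover have "e \<noteq> 0"
          using False' by (metis of_nat_0)
        ultimately have "of_nat e * coeff H e \<in> P"
          by (simp add: coeff_pderiv del: of_nat_Suc)
        then show False
          using lead Const_not_mem_prime[OF P False'] prime_mult_iff[OF P] by (simp add: of_nat_mpoly)
      qed
      \<comment> \<open>Differentiating \<open>?t * poly F ?x = ?q * ?h + ?g\<close> modulo
        \<open>P\<close> leaves only \<open>?q * partial k ?h\<close>, which forces
        \<open>?q\<close> into \<open>P\<close>.\<close>
      have "partial k (?t * poly F ?x) \<in> P"
        unfolding partial_mult using F(2) dF[of k]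
        by (intro ideal_add[OF idP] ideal_mult[OF idP])
      then have "partial k (?q * ?h) + partial k ?g \<in> P"
        unfolding eq partial_add .
      then have "?q * partial k ?h + partial k ?q * ?h \<in> P"
        using dg ideal_diff[OF idP, of "partial k (?q * ?h) + partial k ?g" "partial k ?g"]
        by (simp add: partial_mult)
      then have "?q * partial k ?h \<in> P"
        using ideal_mult[OF idP H(3), of "partial k ?q"]
          ideal_diff[OF idP, of "?q * partial k ?h + partial k ?q * ?h" "partial k ?q * ?h"]
        by simp
      then have "?q \<in> P"
        using dh prime_mult_iff[OF P] by blast
      then have "?t * poly F ?x - ?g \<in> ideal_power P 2"
        using H(3) mult_mem_ideal_square[OF idP] by (simp add: eq)
      moreover have "?t \<notin> P"
        using lead deg prime_power[OF P] by simp
      ultimately show ?thesis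
        using QG(2,3) indep by blast
    next
      case True
      have "e \<noteq> 0"
      proof
        assume "e = 0"
        then obtain c where "H = [:c:]"
          using deg degree_eq_zeroE by blast
        with \<open>e = 0\<close> show False
          using lead H(3) by simp
      qed
      define p where "p = CHAR('k)"
      have "p dvd e"
        using True by (simp add: p_def of_nat_eq_0_iff_char_dvd)
      with \<open>e \<noteq> 0\<close> have p: "p \<noteq> 0" "p \<le> e"
        by (auto dest: dvd_imp_le)
      \<comment> \<open>Monic over \<open>R\<close> with root \<open>?x\<close>, so the remainder
        has the same value as \<open>F\<close>. Its degree is below \<open>p\<close>, and
        \<open>p \<le> e\<close> preserves independence.\<close>
      define h where "h = monom 1 p - [:?x ^ p:]"
      have coeff_h: "coeff h n = (if n = p then 1 else if n = 0 then - (?x ^ p) else 0)" for n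
        using p(1) by (auto simp: h_def coeff_pCons split: nat.split)
      have "?x ^ p \<in> R"
        using DR p(1) by (simp add: diff_subring_def p_def)
      then have "h \<in> polys_over R"
        by (auto simp: polys_over_def coeff_h
            intro: subring_one[OF R] subring_zero[OF R] subring_uminus[OF R])
      moreover have deg_h: "degree h = p"
        by (intro antisym le_degree degree_le) (auto simp: coeff_h)
      ultimately obtain N Q G where QG: "smult (lead_coeff h ^ N) F = Q * h + G"
        "G \<in> polys_over R" "\<forall>n\<ge>p. coeff G n = 0"
        using pseudo_division[OF R _ F(1), of h "Suc (degree F)"] coeff_eq_0[of F] by fastforce
      have "poly h ?x = 0"
        by (simp add: h_def poly_monom)
      then have "1 * poly F ?x - poly G ?x = 0"
        using arg_cong[OF QG(1), of "\<lambda>p. poly p ?x"] by (simp add: deg_h coeff_h)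
      then have "1 * poly F ?x - poly G ?x \<in> ideal_power P 2"
        using ideal_zero[OF is_ideal_power] by metis
      then show ?thesis
        using QG(2,3) prime_one[OF P] independent_powers_antimono[OF indep p(2)] by blast
    qed
  qed
qed

text \<open>After reduction to \<open>G\<close>, independence carries the conditions over to its
  coefficients: derivatives in other variables act coefficientwise, and \<open>partial k\<close>
  kills \<open>R\<close>. Then the assumption on \<open>R\<close> applies to each
  coefficient.\<close>

lemma detects_square_adjoin:
  fixes P R :: "('v::{finite,linorder}, 'k::field) mpoly set"
  assumes P: "prime_ideal P" and DR: "diff_subring A R" and "k \<notin> A"
    and detect: "detects_square P R"
  shows "detects_square P ((\<lambda>F. poly F (Var k)) ` polys_over R)"
  unfolding detects_square_def
proof (intro ballI impI)
  let ?x = "Var k :: ('v, 'k) mpoly"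
  fix f assume "f \<in> (\<lambda>F. poly F ?x) ` polys_over R" and f: "f \<in> P" "\<forall>i. partial i f \<in> P"
  then obtain F where F: "f = poly F ?x" "F \<in> polys_over R"
    by blast
  note idP = prime_is_ideal[OF P] and idP2 = is_ideal_power[of P 2]
  have R: "is_subring R" and d: "\<And>i f. f \<in> R \<Longrightarrow> partial i f \<in> R"
    and d0: "\<And>f. f \<in> R \<Longrightarrow> partial k f = 0"
    using DR \<open>k \<notin> A\<close> by (auto simp: diff_subring_def)
  obtain e t G where t: "t \<notin> P" and w: "t * f - poly G ?x \<in> ideal_power P 2"
    and G: "G \<in> polys_over R" "\<forall>n\<ge>e. coeff G n = 0"
    and indep: "independent_powers R P ?x e"
    using reduce_modulo_square[OF P DR \<open>k \<notin> A\<close> F(2)] f unfolding F(1) by blast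
  have "t * f - poly G ?x \<in> P"
    using w ideal_power_antimono[of 1 2 P] ideal_power_one[OF idP] by auto
  then have g: "poly G ?x \<in> P"
    using ideal_diff[OF idP ideal_mult[OF idP f(1)], of "t * f - poly G ?x" t] by simp
  have dg: "partial i (poly G ?x) \<in> P" for i
  proof -
    have "partial i (t * f) \<in> P"
      unfolding partial_mult using f by (intro ideal_add[OF idP] ideal_mult[OF idP]) auto
    moreover have "partial i (t * f - poly G ?x) \<in> P"
      by (rule partial_mem_of_square[OF idP w])
    ultimately have "partial i (t * f) - partial i (t * f - poly G ?x) \<in> P"
      by (rule ideal_diff[OF idP])
    then show ?thesis
      by (simp add: partial_diff)
  qed
  have coeff_P: "coeff G n \<in> P" for n
    using independent_powersD[OF indep G(1) _ g] G(2) by blast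
  have partial_P: "partial i (coeff G n) \<in> P" for i n
  proof (cases "i = k")
    case True
    then show ?thesis
      using d0 polys_overD[OF G(1)] ideal_zero[OF idP] by simp
  next
    case False
    have "poly (map_poly (partial i) G) ?x \<in> P"
      using dg[of i] False by (simp add: partial_poly partial_Var)
    moreover have "map_poly (partial i) G \<in> polys_over R"
      using G(1) d by (simp add: polys_over_def coeff_map_poly partial_zero)
    moreover have "coeff (map_poly (partial i) G) n = 0" if "n \<ge> e" for n
      using G(2) that by (simp add: coeff_map_poly partial_zero)
    ultimately have "coeff (map_poly (partial i) G) n \<in> P"
      using independent_powersD[OF indep] by blast
    then show ?thesis
      by (simp add: coeff_map_poly partial_zero)
  qed
  have "\<exists>s. s \<notin> P \<and> s * coeff G n \<in> ideal_power P 2" for n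
    using detect polys_overD[OF G(1)] coeff_P partial_P unfolding detects_square_def by blast
  then obtain s where s: "s \<notin> P" "\<forall>n\<in>{..degree G}. s * coeff G n \<in> ideal_power P 2"
    using common_multiplier[OF P idP2, of "{..degree G}" "coeff G"] by auto
  have "s * coeff G n \<in> ideal_power P 2" for n
    using s(2) ideal_zero[OF idP2] coeff_eq_0[of G n] by (cases "n \<le> degree G") auto
  then have "s * poly G ?x \<in> ideal_power P 2"
    by (rule poly_mem_ideal[OF idP2])
  then have "s * (t * f - poly G ?x) + s * poly G ?x \<in> ideal_power P 2"
    using ideal_mult[OF idP2 w] by (intro ideal_add[OF idP2])
  then have "(s * t) * f \<in> ideal_power P 2"
    by (simp add: algebra_simps)
  moreover have "s * t \<notin> P"
    using s(1) t prime_mult_iff[OF P] by blast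
  ultimately show "\<exists>s. s \<notin> P \<and> s * f \<in> ideal_power P 2"
    by blast
qed

section \<open>Rings of constants and the full polynomial ring\<close>

lemma CHAR_mpoly: "CHAR(('v, 'k::comm_ring_1) mpoly) = CHAR('k)"
proof (rule CHAR_eqI)
  have "(of_nat n :: ('v, 'k) mpoly) = 0 \<longleftrightarrow> (of_nat n :: 'k) = 0" for n
    unfolding of_nat_mpoly Const_def by (metis lookup_single_eq lookup_zero single_zero)
  then show "(of_nat CHAR('k) :: ('v, 'k) mpoly) = 0"
    and "\<And>n. (of_nat n :: ('v, 'k) mpoly) = 0 \<Longrightarrow> CHAR('k) dvd n"
    by (simp_all add: of_nat_eq_0_iff_char_dvd)
qed

text \<open>
  The constants to start from are \<open>K\<close> in characteristic \<open>0\<close> and the ring of \<open>p\<close>-th powers in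
  characteristic \<open>p\<close>; the latter contains \<open>K\<close> because \<open>K\<close> is perfect.
\<close>

lemma diff_subring_base:
  fixes P :: "('v::{finite,linorder}, 'k::field) mpoly set"
  assumes perfect: "perfect_field TYPE('k)" and P: "prime_ideal P"
  shows "\<exists>R. diff_subring {} R \<and> detects_square P R"
proof (cases "CHAR('k) = 0")
  case True
  have "is_subring (range Const :: ('v, 'k) mpoly set)"
  proof -
    have "(- 1 :: ('v, 'k) mpoly) = Const (- 1)"
      by (simp add: Const_def single_uminus)
    then show ?thesis
      by (auto simp: is_subring_def simp flip: hom_add[OF is_ring_hom_Const]
          hom_mult[OF is_ring_hom_Const])
  qed
  moreover from this have "(0 :: ('v, 'k) mpoly) \<in> range Const"
    by (rule subring_zero)
  ultimately have "diff_subring {} (range Const :: ('v, 'k) mpoly set)"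
    using True unfolding diff_subring_def by (auto simp only: partial_Const)
  moreover have "detects_square P (range Const)"
    unfolding detects_square_def
  proof (intro ballI impI)
    fix f assume "f \<in> range Const" "f \<in> P"
    then obtain c where c: "f = Const c" "Const c \<in> P"
      by blast
    then have "c = 0"
      using Const_not_mem_prime[OF P] by blast
    then have "f = 0"
      using c(1) hom_zero[OF is_ring_hom_Const] by simp
    then show "\<exists>s. s \<notin> P \<and> s * f \<in> ideal_power P 2"
      using prime_one[OF P] ideal_zero[OF is_ideal_power] by auto
  qed
  ultimately show ?thesis
    by blast
next
  case False
  define p where "p = CHAR('k)"
  have prime: "prime p"
    using False prime_CHAR_semidom[where 'a = 'k] by (simp add: p_def)
  then have p: "p \<ge> 2"
    by (rule prime_ge_2_nat)
  let ?R = "range (\<lambda>f :: ('v, 'k) mpoly. f ^ p)"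
  have Const: "Const c \<in> ?R" for c
  proof -
    obtain b where "c = b ^ p"
      using perfect False unfolding perfect_field_def p_def by (metis surjD)
    then have "Const c = Const b ^ p"
      by (simp add: hom_power[OF is_ring_hom_Const])
    then show ?thesis
      by blast
  qed
  have "is_subring ?R"
  proof -
    have "(- 1 :: ('v, 'k) mpoly) = Const (- 1)"
      by (simp add: Const_def single_uminus)
    then have "- 1 \<in> ?R"
      using Const by simp
    moreover have "f ^ p + g ^ p \<in> ?R" "f ^ p * g ^ p \<in> ?R" for f g :: "('v, 'k) mpoly"
    proof -
      have "f ^ p + g ^ p = (f + g) ^ p"
        by (rule freshmans_dream[symmetric]) (use prime in \<open>simp_all add: CHAR_mpoly p_def\<close>)
      moreover have "f ^ p * g ^ p = (f * g) ^ p"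
        by (rule power_mult_distrib[symmetric])
      ultimately show "f ^ p + g ^ p \<in> ?R" "f ^ p * g ^ p \<in> ?R"
        by blast+
    qed
    ultimately show ?thesis
      by (auto simp: is_subring_def)
  qed
  moreover from this have "0 \<in> ?R"
    by (rule subring_zero)
  moreover have "partial i (f ^ p) = 0" for i and f :: "('v, 'k) mpoly"
    by (simp add: partial_power of_nat_mpoly p_def Const_def)
  moreover have "range Const \<subseteq> ?R"
    using Const by blast
  ultimately have "diff_subring {} ?R"
    unfolding diff_subring_def by (auto simp only: p_def)
  moreover have "detects_square P ?R"
    unfolding detects_square_def
  proof (intro ballI impI)
    fix f assume "f \<in> ?R" "f \<in> P"
    \<comment> \<open>A p-th power in the prime \<open>P\<close> has its root in \<open>P\<close>;
      as \<open>p \<ge> 2\<close>, it already lies in the square.\<close>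
    then obtain a where a: "f = a ^ p" "a \<in> P"
      using prime_power[OF P] by blast
    obtain m where m: "p = Suc (Suc m)"
      using p by (metis le_Suc_ex numeral_2_eq_2 plus_nat.simps)
    have "a * a ^ m \<in> P"
      by (rule ideal_mult_right[OF prime_is_ideal[OF P] a(2)])
    then have "1 * f \<in> ideal_power P 2"
      using mult_mem_ideal_square[OF prime_is_ideal[OF P] a(2)] by (simp add: a(1) m)
    then show "\<exists>s. s \<notin> P \<and> s * f \<in> ideal_power P 2"
      using prime_one[OF P] by blast
  qed
  ultimately show ?thesis
    by blast
qed

text \<open>The variables are adjoined one by one to the ring of constants; with all of them
  adjoined, the ring contains every polynomial.\<close>

lemma mem_square_of_partials:
  fixes P :: "('v::{finite,linorder}, 'k::field) mpoly set"
  assumes perfect: "perfect_field TYPE('k)" and P: "prime_ideal P"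
    and "f \<in> P" "\<And>i. partial i f \<in> P"
  shows "\<exists>s. s \<notin> P \<and> s * f \<in> ideal_power P 2"
proof -
  have "\<exists>R. diff_subring A R \<and> detects_square P R" for A :: "'v set"
    using finite[of A]
  proof (induction A rule: finite_induct)
    case empty
    show ?case
      by (rule diff_subring_base[OF perfect P])
  next
    case (insert k A)
    then obtain R where "diff_subring A R" "detects_square P R"
      by blast
    with diff_subring_adjoin[of A R k] detects_square_adjoin[OF P, of A R k] insert.hyps(2)
    show ?case
      by blast
  qed
  then obtain R where R: "diff_subring UNIV R" "detects_square P R"
    by blast
  then have "is_subring R" "\<And>c. Const c \<in> R" "\<And>i. Var i \<in> R"
    by (auto simp: diff_subring_def)
  then have "f \<in> R"
    by (induction f rule: mpoly_induct) (simp_all add: subring_add subring_mult)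
  with R(2) assms(3,4) show ?thesis
    unfolding detects_square_def by blast
qed

section \<open>Transversal coordinates at a prime\<close>

text \<open>Modulo \<open>P\<close> the Jacobian block of \<open>u\<close> on \<open>I\<close> is
  \<open>s\<close> times the identity; the scalar \<open>s\<close> outside \<open>P\<close> avoids
  division.\<close>

definition dual_coordinates ::
    "('v::finite, 'k::comm_ring_1) mpoly set \<Rightarrow> 'v set \<Rightarrow> ('v \<Rightarrow> ('v, 'k) mpoly)
       \<Rightarrow> ('v, 'k) mpoly \<Rightarrow> bool" where
  "dual_coordinates P I u s \<longleftrightarrow> s \<notin> P \<and> (\<forall>i. u i \<in> P) \<and>
     (\<forall>i\<in>I. \<forall>j\<in>I. partial j (u i) - (if i = j then s else 0) \<in> P)"

text \<open>One step of Gauss--Jordan elimination on the Jacobian matrix modulo \<open>P\<close>.\<close>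

lemma dual_coordinates_insert:
  assumes P: "prime_ideal P" and I: "dual_coordinates P I u s" and "k \<notin> I"
    and b: "b \<in> P" "\<And>j. j \<in> I \<Longrightarrow> partial j b \<in> P" "partial k b \<notin> P"
  shows "dual_coordinates P (insert k I)
    (\<lambda>i. if i = k then s * b else partial k b * u i - partial k (u i) * b) (s * partial k b)"
    (is "dual_coordinates P _ ?u ?s")
proof -
  note idP = prime_is_ideal[OF P]
  note ideal = ideal_add[OF idP] ideal_diff[OF idP] ideal_mult[OF idP]
  have s: "s \<notin> P" and u: "\<And>i. u i \<in> P"
    and du: "\<And>i j. i \<in> I \<Longrightarrow> j \<in> I \<Longrightarrow> partial j (u i) - (if i = j then s else 0) \<in> P"
    using I by (auto simp: dual_coordinates_def)
  have "partial j (?u i) - (if i = j then ?s else 0) \<in> P"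
    if i: "i \<in> insert k I" and j: "j \<in> insert k I" for i j
  proof (cases "i = k")
    case True
    have "partial j (?u i) - (if i = j then ?s else 0)
        = s * (if j = k then 0 else partial j b) + partial j s * b"
      using True by (auto simp: partial_mult)
    also have "\<dots> \<in> P"
      using b j ideal_zero[OF idP] by (intro ideal) auto
    finally show ?thesis .
  next
    case False
    with i have "i \<in> I" "i \<noteq> k"
      by auto
    show ?thesis
    proof (cases "j = k")
      case True
      have "partial j (?u i) - (if i = j then ?s else 0)
          = partial k (partial k b) * u i - partial k (partial k (u i)) * b"
        using True False by (simp add: partial_mult partial_diff algebra_simps)
      also have "\<dots> \<in> P"
        by (intro ideal b u)
      finally show ?thesis .
    next
      case j': False
      then have "j \<in> I"
        using j by simp
      have "partial j (?u i) - (if i = j then ?s else 0)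
          = partial k b * (partial j (u i) - (if i = j then s else 0))
            + partial j (partial k b) * u i - partial j (partial k (u i)) * b
            - partial k (u i) * partial j b"
        using False by (simp add: partial_mult partial_diff algebra_simps)
      also have "\<dots> \<in> P"
        by (intro ideal b u du \<open>i \<in> I\<close> \<open>j \<in> I\<close>)
      finally show ?thesis .
    qed
  qed
  moreover have "?s \<notin> P"
    using s b prime_mult_iff[OF P] by simp
  moreover have "?u i \<in> P" for i
  proof -
    have "s * b \<in> P" "partial k b * u i - partial k (u i) * b \<in> P"
      by (intro ideal b u)+
    then show ?thesis
      by simp
  qed
  ultimately show ?thesis
    unfolding dual_coordinates_def by blast
qed

text \<open>Take \<open>I\<close> maximal. If the correction \<open>b\<close> of an element of
  \<open>P\<close> still had a derivative outside \<open>P\<close>, elimination would enlarge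
  \<open>I\<close>. So all its derivatives are in \<open>P\<close>, and \<open>b\<close> is locally
  in the square.\<close>

lemma transversal_coordinates:
  fixes P :: "('v::{finite,linorder}, 'k::field) mpoly set"
  assumes perfect: "perfect_field TYPE('k)" and P: "prime_ideal P"
  shows "\<exists>I u s. dual_coordinates P I u s \<and>
    (\<forall>a\<in>P. \<exists>t c. t \<notin> P \<and> t * a - (\<Sum>i\<in>I. c i * u i) \<in> ideal_power P 2)"
proof -
  note idP = prime_is_ideal[OF P]
  define \<I> where "\<I> = {I. \<exists>u s. dual_coordinates P I u s}"
  have "dual_coordinates P {} (\<lambda>_. 0) 1"
    by (simp add: dual_coordinates_def prime_one[OF P] ideal_zero[OF idP])
  then have "{} \<in> \<I>"
    unfolding \<I>_def by blast
  then obtain I where "I \<in> \<I>" and max: "\<And>I'. I' \<in> \<I> \<Longrightarrow> I \<subseteq> I' \<Longrightarrow> I' = I"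
    using finite_has_maximal[of \<I>] by (metis empty_iff finite)
  then obtain u s where dual: "dual_coordinates P I u s"
    unfolding \<I>_def by blast
  then have s: "s \<notin> P" and u: "\<And>i. u i \<in> P"
    and du: "\<And>i j. i \<in> I \<Longrightarrow> j \<in> I \<Longrightarrow> partial j (u i) - (if i = j then s else 0) \<in> P"
    by (auto simp: dual_coordinates_def)
  have "\<exists>t c. t \<notin> P \<and> t * a - (\<Sum>i\<in>I. c i * u i) \<in> ideal_power P 2" if a: "a \<in> P" for a
  proof -
    \<comment> \<open>The sum has the same derivatives along \<open>I\<close> as
      \<open>s * a\<close>, modulo \<open>P\<close>.\<close>
    define b where "b = s * a - (\<Sum>i\<in>I. partial i a * u i)"
    have b: "b \<in> P"
      unfolding b_def
      by (intro ideal_diff[OF idP] ideal_mult[OF idP] ideal_sum_mem[OF idP] a u)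
    have partial_sum: "partial j (\<Sum>i\<in>A. g i) = (\<Sum>i\<in>A. partial j (g i))"
      for j A and g :: "'v \<Rightarrow> ('v, 'k) mpoly"
      by (induction A rule: infinite_finite_induct) (simp_all add: partial_zero partial_add)
    have dI: "partial j b \<in> P" if "j \<in> I" for j
    proof -
      have "(\<Sum>i\<in>I. partial i a * (if i = j then s else 0)) = partial j a * s"
        using that by (simp add: if_distrib[of "(*) _"] cong: if_cong)
      then have "partial j b = partial j s * a - (\<Sum>i\<in>I. partial j (partial i a) * u i)
          - (\<Sum>i\<in>I. partial i a * (partial j (u i) - (if i = j then s else 0)))"
        unfolding right_diff_distrib sum_subtractf
        by (simp add: b_def partial_diff partial_mult partial_sum sum.distrib)
      also have "\<dots> \<in> P"
        using that by (intro ideal_diff[OF idP] ideal_mult[OF idP] ideal_sum_mem[OF idP] a u du)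
      finally show ?thesis .
    qed
    have "partial k b \<in> P" for k
    proof (rule ccontr)
      assume k: "partial k b \<notin> P"
      then have "k \<notin> I"
        using dI by blast
      from dual_coordinates_insert[OF P dual this b dI k] have "insert k I \<in> \<I>"
        unfolding \<I>_def by blast
      with max[of "insert k I"] \<open>k \<notin> I\<close> show False
        by blast
    qed
    then obtain t where t: "t \<notin> P" "t * b \<in> ideal_power P 2"
      using mem_square_of_partials[OF perfect P b] by blast
    have "t * b = (t * s) * a - (\<Sum>i\<in>I. (t * partial i a) * u i)"
      by (simp add: b_def algebra_simps sum_distrib_left)
    moreover have "t * s \<notin> P"
      using t(1) s prime_mult_iff[OF P] by blast
    ultimately show ?thesis
      using t(2) by (intro exI[of _ "t * s"] exI[of _ "\<lambda>i. t * partial i a"]) simp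
  qed
  with dual show ?thesis
    by blast
qed

section \<open>Homogeneous leading forms\<close>

definition homogeneous_in :: "'v::finite set \<Rightarrow> nat \<Rightarrow> ('v, 'a::comm_ring_1) mpoly set" where
  "homogeneous_in I n = {F. \<forall>m. lookup F m \<noteq> 0 \<longrightarrow> keys m \<subseteq> I \<and> total_degree m = n}"

lemma homogeneous_in_add:
  assumes "F \<in> homogeneous_in I n" "G \<in> homogeneous_in I n"
  shows "F + G \<in> homogeneous_in I n"
  unfolding homogeneous_in_def
proof (intro CollectI allI impI)
  fix m assume "lookup (F + G) m \<noteq> 0"
  then have "lookup F m \<noteq> 0 \<or> lookup G m \<noteq> 0"
    by (auto simp: lookup_add)
  with assms show "keys m \<subseteq> I \<and> total_degree m = n"
    unfolding homogeneous_in_def by blast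
qed

lemma homogeneous_in_zero: "0 \<in> homogeneous_in I n"
  by (simp add: homogeneous_in_def)

lemma homogeneous_in_sum:
  "(\<And>a. a \<in> A \<Longrightarrow> f a \<in> homogeneous_in I n) \<Longrightarrow> sum f A \<in> homogeneous_in I n"
  by (induction A rule: infinite_finite_induct)
    (auto intro: homogeneous_in_zero homogeneous_in_add)

lemma homogeneous_in_Const: "Const c \<in> homogeneous_in I 0"
  by (auto simp: homogeneous_in_def lookup_Const total_degree_zero)

lemma homogeneous_in_Var: "i \<in> I \<Longrightarrow> Var i \<in> homogeneous_in I 1"
  by (auto simp: homogeneous_in_def Var_def lookup_single when_def total_degree_single
      split: if_splits)

lemma homogeneous_in_mult:
  assumes "F \<in> homogeneous_in I d" "G \<in> homogeneous_in I e"
  shows "F * G \<in> homogeneous_in I (d + e)"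
proof -
  have "lookup (F * G) m \<in> {0}" if m: "\<not> (keys m \<subseteq> I \<and> total_degree m = d + e)" for m
  proof (rule lookup_mult_mem_ideal[OF is_ideal_singleton_zero])
    fix k l assume kl: "m = k + l"
    have "keys m \<subseteq> keys k \<union> keys l"
      unfolding kl by (rule keys_add)
    with m kl have "\<not> (keys k \<subseteq> I \<and> total_degree k = d) \<or> \<not> (keys l \<subseteq> I \<and> total_degree l = e)"
      by (auto simp: total_degree_add)
    then have "lookup F k = 0 \<or> lookup G l = 0"
      using assms unfolding homogeneous_in_def by blast
    then show "lookup F k * lookup G l \<in> {0}"
      by auto
  qed
  then show ?thesis
    unfolding homogeneous_in_def by blast
qed

lemma ideal_power_mult:
  "a \<in> ideal_power I m \<Longrightarrow> b \<in> ideal_power I n \<Longrightarrow> a * b \<in> ideal_power I (m + n)"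
proof (induction m arbitrary: a)
  case 0
  then show ?case
    by (simp add: ideal_mult[OF is_ideal_power])
next
  case (Suc m)
  from Suc.prems(1) show ?case
  proof (induction rule: ideal_power_Suc_induct)
    case zero
    show ?case
      by (simp add: ideal_zero[OF is_ideal_power] del: ideal_power.simps)
  next
    case (step c d y)
    have "(c * d + y) * b = c * (d * b) + y * b"
      by (simp add: algebra_simps)
    moreover have "c * (d * b) \<in> ideal_power I (Suc (m + n))"
      using step(1) Suc.IH[OF step(2) Suc.prems(2)] by (rule ideal_power_SucI)
    ultimately show ?case
      using step(3) by (simp add: ideal_add[OF is_ideal_power] del: ideal_power.simps)
  qed
qed

text \<open>In a product, the factor from \<open>P\<close> is replaced by a linear form in
  \<open>u\<close> and the other factor, by induction, by a form of degree \<open>n\<close>.\<close>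

lemma ideal_power_leading_form:
  fixes P :: "'a::comm_ring_1 set" and u :: "'v::finite \<Rightarrow> 'a"
  assumes P: "prime_ideal P" and u: "\<And>i. u i \<in> P"
    and gen: "\<And>a. a \<in> P \<Longrightarrow> \<exists>t c. t \<notin> P \<and> t * a - (\<Sum>i\<in>I. c i * u i) \<in> ideal_power P 2"
    and "f \<in> ideal_power P n"
  shows "\<exists>t F. t \<notin> P \<and> F \<in> homogeneous_in I n \<and>
    t * f - mpoly_eval (\<lambda>c. c) u F \<in> ideal_power P (Suc n)"
  using assms(4)
proof (induction n arbitrary: f)
  case 0
  have "1 * f - mpoly_eval (\<lambda>c. c) u (Const f) \<in> ideal_power P (Suc 0)"
    using ideal_zero[OF is_ideal_power[of P "Suc 0"]]
    by (simp add: mpoly_eval_Const is_ring_hom_id del: ideal_power.simps)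
  then show ?case
    using prime_one[OF P] homogeneous_in_Const by blast
next
  case (Suc n)
  let ?\<epsilon> = "mpoly_eval (\<lambda>c. c) u"
  note hom = is_ring_hom_mpoly_eval[OF is_ring_hom_id, of u]
  note idP = is_ideal_power[of P "Suc (Suc n)"]
  from Suc.prems show ?case
  proof (induction rule: ideal_power_Suc_induct)
    case zero
    have "1 * 0 - ?\<epsilon> 0 \<in> ideal_power P (Suc (Suc n))"
      using ideal_zero[OF idP] by (simp add: hom_zero[OF hom] del: ideal_power.simps)
    then show ?case
      using prime_one[OF P] homogeneous_in_zero by blast
  next
    case (step a b y)
    obtain t1 F1 where 1: "t1 \<notin> P" "F1 \<in> homogeneous_in I (Suc n)"
      "t1 * y - ?\<epsilon> F1 \<in> ideal_power P (Suc (Suc n))"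
      using step(3) by blast
    obtain t2 F2 where 2: "t2 \<notin> P" "F2 \<in> homogeneous_in I n"
      "t2 * b - ?\<epsilon> F2 \<in> ideal_power P (Suc n)"
      using Suc.IH[OF step(2)] by blast
    obtain t3 c where 3: "t3 \<notin> P" "t3 * a - (\<Sum>i\<in>I. c i * u i) \<in> ideal_power P 2"
      using gen[OF step(1)] by blast
    define A where "A = (\<Sum>i\<in>I. Const (c i) * Var i)"
    have \<epsilon>A: "?\<epsilon> A = (\<Sum>i\<in>I. c i * u i)"
      by (simp add: A_def hom_sum[OF hom] hom_mult[OF hom] mpoly_eval_Const mpoly_eval_Var
          is_ring_hom_id)
    have "A \<in> homogeneous_in I (0 + 1)"
      unfolding A_def
      by (intro homogeneous_in_sum homogeneous_in_mult homogeneous_in_Const homogeneous_in_Var)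
    then have "Const t1 * (A * F2) + Const (t2 * t3) * F1 \<in> homogeneous_in I (Suc n)"
      using 1 2 homogeneous_in_mult[OF homogeneous_in_Const, of F1 I "Suc n" "t2 * t3"]
        homogeneous_in_mult[OF homogeneous_in_Const, of "A * F2" I "Suc n" t1]
        homogeneous_in_mult[of A I 1 F2 n]
      by (simp add: homogeneous_in_add)
    moreover have "t1 * t2 * t3 \<notin> P"
      using 1 2 3 prime_mult_iff[OF P] by blast
    moreover have "(t1 * t2 * t3) * (a * b + y)
        - ?\<epsilon> (Const t1 * (A * F2) + Const (t2 * t3) * F1) \<in> ideal_power P (Suc (Suc n))"
    proof -
      \<comment> \<open>Three errors, all in exponent \<open>n + 2\<close>: that of \<open>a\<close>
        (exponent 2) times \<open>b\<close> (exponent \<open>n\<close>), the linear form (exponent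
        1) times that of \<open>b\<close> (exponent \<open>n + 1\<close>), and that of
        \<open>y\<close>.\<close>
      have "(t1 * t2 * t3) * (a * b + y) - ?\<epsilon> (Const t1 * (A * F2) + Const (t2 * t3) * F1)
          = (t1 * t2) * ((t3 * a - ?\<epsilon> A) * b) + t1 * (?\<epsilon> A * (t2 * b - ?\<epsilon> F2))
            + (t2 * t3) * (t1 * y - ?\<epsilon> F1)"
        by (simp add: hom_add[OF hom] hom_mult[OF hom] mpoly_eval_Const is_ring_hom_id
            algebra_simps)
      moreover have "(t3 * a - ?\<epsilon> A) * b \<in> ideal_power P (Suc (Suc n))"
        using ideal_power_mult[of "t3 * a - ?\<epsilon> A" P 2 b n] 3(2) step(2)
        by (simp add: \<epsilon>A del: ideal_power.simps)
      moreover have "?\<epsilon> A \<in> P"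
        unfolding \<epsilon>A
        by (intro ideal_sum_mem ideal_mult prime_is_ideal[OF P] u)
      then have "?\<epsilon> A * (t2 * b - ?\<epsilon> F2) \<in> ideal_power P (Suc (Suc n))"
        using 2(3) by (rule ideal_power_SucI)
      ultimately show ?thesis
        using 1(3) by (simp only: ideal_add[OF idP] ideal_mult[OF idP])
    qed
    ultimately show ?case
      by blast
  qed
qed

text \<open>Equality of leading forms: order at least \<open>d\<close> modulo \<open>P\<close> in
  the directions \<open>I\<close>, with the same part of degree \<open>d\<close>.\<close>

definition approx ::
    "'a::comm_ring_1 set \<Rightarrow> 'v::finite set \<Rightarrow> nat \<Rightarrow> ('v, 'a) mpoly \<Rightarrow> ('v, 'a) mpoly \<Rightarrow> bool" where
  "approx P I d F G \<longleftrightarrow>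
     F \<in> low_coeffs_in P I d \<and> G \<in> low_coeffs_in P I d \<and> F - G \<in> low_coeffs_in P I (Suc d)"

context
  fixes P :: "'a::comm_ring_1 set" and I :: "'v::finite set"
  assumes P: "is_ideal P"
begin

lemma approx_mult:
  assumes "approx P I d F G" "approx P I e F' G'"
  shows "approx P I (d + e) (F * F') (G * G')"
proof -
  have "F * F' - G * G' = (F - G) * F' + G * (F' - G')"
    by (simp add: algebra_simps)
  moreover have "(F - G) * F' \<in> low_coeffs_in P I (Suc d + e)"
    "G * (F' - G') \<in> low_coeffs_in P I (d + Suc e)"
    using assms unfolding approx_def by (blast intro: low_coeffs_in_mult[OF P])+
  ultimately have "F * F' - G * G' \<in> low_coeffs_in P I (Suc (d + e))"
    by (simp add: ideal_add[OF is_ideal_low_coeffs_in[OF P]])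
  then show ?thesis
    using assms unfolding approx_def by (blast intro: low_coeffs_in_mult[OF P])
qed

lemma approx_refl_0: "approx P I 0 F F"
  by (simp add: approx_def low_coeffs_in_0 ideal_zero[OF is_ideal_low_coeffs_in[OF P]])

lemma approx_power: "approx P I 1 F G \<Longrightarrow> approx P I k (F ^ k) (G ^ k)"
proof (induction k)
  case (Suc k)
  then show ?case
    using approx_mult[of 1 F G k "F ^ k" "G ^ k"] by simp
qed (simp add: approx_refl_0)

lemma approx_prod:
  "finite A \<Longrightarrow> (\<And>i. i \<in> A \<Longrightarrow> approx P I (d i) (F i) (G i)) \<Longrightarrow>
     approx P I (sum d A) (prod F A) (prod G A)"
  by (induction A rule: finite_induct) (simp_all add: approx_refl_0 approx_mult)

end

section \<open>Leading forms of Taylor expansions\<close>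

lemma approx_taylor_Const:
  "is_ideal P \<Longrightarrow> approx P I 0 (taylor c) (Const c)"
  using taylor_minus_Const[of c] order_ge_subset_low_coeffs_in[of P 1 I]
  by (auto simp: approx_def low_coeffs_in_0)

lemma total_degree_less_2:
  assumes "total_degree m < 2"
  shows "m = 0 \<or> (\<exists>k. m = single k 1)"
proof (cases "total_degree m = 0")
  case False
  with assms have "(\<Sum>i\<in>UNIV. lookup m i) = Suc 0"
    unfolding total_degree_def by linarith
  then obtain k where k: "lookup m k = 1" "\<And>j. j \<noteq> k \<Longrightarrow> lookup m j = 0"
    by (auto simp: sum_eq_Suc0_iff)
  then have "m = single k 1"
    by (intro poly_mapping_eqI) (auto simp: lookup_single when_def)
  then show ?thesis
    by blast
qed (simp add: total_degree_eq_0_iff)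

text \<open>The constant coefficient is \<open>u i\<close>, an element of \<open>P\<close>, and the
  linear ones are the partial derivatives prescribed by \<open>dual_coordinates\<close>.\<close>

lemma approx_taylor_coordinate:
  fixes P :: "('v::finite, 'k::comm_ring_1) mpoly set"
  assumes P: "is_ideal P" and dual: "dual_coordinates P I u s" and "i \<in> I"
  shows "approx P I 1 (taylor (u i)) (Const s * Var i)"
proof -
  have Var0: "lookup (Var i :: ('v, ('v, 'k) mpoly) mpoly) 0 = 0"
    using low_coeffs_inD[OF Var_order_ge_1[of i], of 0] by (simp add: total_degree_zero)
  have 0: "lookup (taylor (u i)) 0 \<in> P" "lookup (Const s * Var i) 0 = 0"
    using dual by (simp_all add: lookup_taylor_0 dual_coordinates_def lookup_Const_mult Var0)
  have 1: "lookup (taylor (u i) - Const s * Var i) (single k 1) \<in> P" if "k \<in> I" for k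
  proof -
    have "lookup (Var i) (single k 1) = (if i = k then 1 else (0 :: ('v, 'k) mpoly))"
      by (metis Var_def lookup_single_eq lookup_single_not_eq one_neq_zero)
    then have "lookup (taylor (u i) - Const s * Var i) (single k 1)
        = partial k (u i) - (if i = k then s else 0)"
      by (simp add: partial_def lookup_minus lookup_Const_mult)
    also have "\<dots> \<in> P"
      using dual that \<open>i \<in> I\<close> unfolding dual_coordinates_def by blast
    finally show ?thesis .
  qed
  have "lookup (taylor (u i) - Const s * Var i) m \<in> P"
    if "keys m \<subseteq> I" "total_degree m < 2" for m
    using total_degree_less_2[OF that(2)]
  proof (elim disjE exE)
    assume "m = 0"
    then show ?thesis
      using 0 by (simp add: lookup_minus)
  next
    fix k assume "m = single k 1"
    moreover from this have "k \<in> I"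
      using that(1) by simp
    ultimately show ?thesis
      using 1 by simp
  qed
  with 0 show ?thesis
    by (simp add: approx_def low_coeffs_in_def total_degree_eq_0_iff numeral_2_eq_2
        ideal_zero[OF P])
qed

text \<open>Leading forms multiply: a monomial of degree \<open>n\<close> in the \<open>u i\<close>
  contributes \<open>s ^ n\<close> times the same monomial in y, and a coefficient contributes its
  constant term.\<close>

lemma taylor_leading_form:
  fixes P :: "('v::finite, 'k::comm_ring_1) mpoly set"
  assumes P: "is_ideal P" and dual: "dual_coordinates P I u s" and F: "F \<in> homogeneous_in I n"
  shows "taylor (mpoly_eval (\<lambda>c. c) u F) - Const (s ^ n) * F \<in> low_coeffs_in P I (Suc n)"
proof -
  have "taylor (lookup F m) * (\<Prod>i\<in>UNIV. taylor (u i) ^ lookup m i)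
      - Const (s ^ n) * single m (lookup F m) \<in> low_coeffs_in P I (Suc n)"
    if "m \<in> keys F" for m
  proof -
    have m: "keys m \<subseteq> I" "total_degree m = n"
      using that F by (auto simp: homogeneous_in_def in_keys_iff)
    have "approx P I (lookup m i) (taylor (u i) ^ lookup m i) ((Const s * Var i) ^ lookup m i)" for i
    proof (cases "i \<in> I")
      case True
      then show ?thesis
        by (intro approx_power[OF P] approx_taylor_coordinate[OF P dual])
    next
      case False
      then have "lookup m i = 0"
        using m(1) by (meson in_keys_iff subsetD)
      then show ?thesis
        by (simp add: approx_refl_0[OF P])
    qed
    then have "approx P I n (\<Prod>i\<in>UNIV. taylor (u i) ^ lookup m i)
        (\<Prod>i\<in>UNIV. (Const s * Var i) ^ lookup m i)"
      unfolding m(2)[symmetric] total_degree_def by (intro approx_prod[OF P]) auto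
    from approx_mult[OF P approx_taylor_Const[OF P] this]
    have "taylor (lookup F m) * (\<Prod>i\<in>UNIV. taylor (u i) ^ lookup m i)
      - Const (lookup F m) * (\<Prod>i\<in>UNIV. (Const s * Var i) ^ lookup m i) \<in> low_coeffs_in P I (Suc n)"
      by (simp add: approx_def)
    moreover have "(\<Prod>i\<in>UNIV. (Const s * Var i) ^ lookup m i)
        = Const (s ^ n) * (\<Prod>i\<in>UNIV. (Var i :: ('v, ('v, 'k) mpoly) mpoly) ^ lookup m i)"
      by (simp add: power_mult_distrib prod.distrib hom_power[OF is_ring_hom_Const]
          m(2)[symmetric] total_degree_def flip: power_sum)
    ultimately show ?thesis
      by (simp add: single_eq_Const_mult_Var[of m "lookup F m"] mult_ac)
  qed
  then have "(\<Sum>m\<in>keys F. taylor (lookup F m) * (\<Prod>i\<in>UNIV. taylor (u i) ^ lookup m i)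
      - Const (s ^ n) * single m (lookup F m)) \<in> low_coeffs_in P I (Suc n)"
    by (rule ideal_sum_mem[OF is_ideal_low_coeffs_in[OF P]])
  also have "(\<Sum>m\<in>keys F. taylor (lookup F m) * (\<Prod>i\<in>UNIV. taylor (u i) ^ lookup m i)
      - Const (s ^ n) * single m (lookup F m))
      = taylor (mpoly_eval (\<lambda>c. c) u F) - Const (s ^ n) * F"
    by (simp add: mpoly_eval_def sum_subtractf hom_sum[OF is_ring_hom_taylor] taylor_mult
        hom_prod[OF is_ring_hom_taylor] hom_power[OF is_ring_hom_taylor] sum_single_lookup
        flip: sum_distrib_left)
  finally show ?thesis .
qed

lemma taylor_ideal_power:
  fixes P :: "('v::finite, 'k::comm_ring_1) mpoly set"
  assumes P: "is_ideal P"
  shows "w \<in> ideal_power P n \<Longrightarrow> taylor w \<in> low_coeffs_in P I n"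
proof (induction n arbitrary: w)
  case 0
  then show ?case
    by (simp add: low_coeffs_in_0)
next
  case (Suc n)
  note id = is_ideal_low_coeffs_in[OF P]
  from Suc.prems show ?case
  proof (induction rule: ideal_power_Suc_induct)
    case zero
    show ?case
      by (simp add: taylor_zero ideal_zero[OF id])
  next
    case (step a b y)
    have "taylor a \<in> low_coeffs_in P I 1"
      using step(1) by (simp add: low_coeffs_in_def total_degree_eq_0_iff lookup_taylor_0)
    from low_coeffs_in_mult[OF P this Suc.IH[OF step(2)]] step(3) show ?case
      by (simp add: taylor_add taylor_mult ideal_add[OF id])
  qed
qed

text \<open>
  Modulo \<open>P\<close> the leading form of \<open>f\<close> in the coordinates \<open>u\<close> is read off, up to a power of \<open>s\<close>, from
  the lowest coefficients of its Taylor expansion in the directions \<open>I\<close>.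
\<close>

lemma mem_ideal_power_of_taylor:
  fixes P :: "('v::finite, 'k::comm_ring_1) mpoly set"
  assumes P: "prime_ideal P" and dual: "dual_coordinates P I u s"
    and gen: "\<And>a. a \<in> P \<Longrightarrow> \<exists>t c. t \<notin> P \<and> t * a - (\<Sum>i\<in>I. c i * u i) \<in> ideal_power P 2"
    and "taylor f \<in> low_coeffs_in P I n"
  shows "\<exists>t. t \<notin> P \<and> t * f \<in> ideal_power P n"
  using assms(4)
proof (induction n)
  case 0
  then show ?case
    using prime_one[OF P] by auto
next
  case (Suc n)
  let ?\<epsilon> = "mpoly_eval (\<lambda>c. c) u"
  note idP = prime_is_ideal[OF P]
  note idE = is_ideal_low_coeffs_in[OF idP, of I "Suc n"]
  have s: "s \<notin> P" and u: "\<And>i. u i \<in> P"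
    using dual by (auto simp: dual_coordinates_def)
  \<comment> \<open>The weaker condition for \<open>n\<close> already gives \<open>P ^ n\<close>; it
    remains to show that the leading form of \<open>t * f\<close> has coefficients in
    \<open>P\<close>.\<close>
  obtain t where t: "t \<notin> P" "t * f \<in> ideal_power P n"
    using Suc low_coeffs_in_antimono[of n "Suc n" P I] by auto
  obtain t' F where t': "t' \<notin> P" and F: "F \<in> homogeneous_in I n"
    and w: "t' * (t * f) - ?\<epsilon> F \<in> ideal_power P (Suc n)"
    using ideal_power_leading_form[OF P u gen t(2)] by blast
  have "taylor (t' * (t * f)) \<in> low_coeffs_in P I (Suc n)"
    unfolding taylor_mult by (intro ideal_mult[OF idE] Suc.prems)
  moreover have "taylor (t' * (t * f) - ?\<epsilon> F) \<in> low_coeffs_in P I (Suc n)"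
    by (rule taylor_ideal_power[OF idP w])
  ultimately have "taylor (t' * (t * f)) - taylor (t' * (t * f) - ?\<epsilon> F) \<in> low_coeffs_in P I (Suc n)"
    by (rule ideal_diff[OF idE])
  then have "taylor (?\<epsilon> F) \<in> low_coeffs_in P I (Suc n)"
    by (simp add: taylor_diff)
  from ideal_diff[OF idE this taylor_leading_form[OF idP dual F]]
  have sF: "Const (s ^ n) * F \<in> low_coeffs_in P I (Suc n)"
    by simp
  \<comment> \<open>After cancelling \<open>s ^ n\<close> each coefficient of \<open>F\<close> is in
    \<open>P\<close>, and it multiplies a monomial of degree \<open>n\<close> in elements of
    \<open>P\<close>.\<close>
  have "?\<epsilon> F \<in> ideal_power P (Suc n)"
    unfolding mpoly_eval_def
  proof (rule ideal_sum_mem[OF is_ideal_power])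
    fix m assume "m \<in> keys F"
    then have m: "keys m \<subseteq> I" "total_degree m = n"
      using F by (auto simp: homogeneous_in_def in_keys_iff)
    then have "s ^ n * lookup F m \<in> P"
      using low_coeffs_inD[OF sF, of m] by (simp add: lookup_Const_mult)
    then have "lookup F m \<in> P"
      using s prime_mult_iff[OF P] prime_power[OF P] by blast
    moreover have "(\<Prod>i\<in>UNIV. u i ^ lookup m i) \<in> ideal_power P n"
      unfolding m(2)[symmetric] total_degree_def using u
      by (intro prod_power_mem_ideal_power) auto
    ultimately show "lookup F m * (\<Prod>i\<in>UNIV. u i ^ lookup m i) \<in> ideal_power P (Suc n)"
      by (rule ideal_power_SucI)
  qed
  with w have "t' * (t * f) - ?\<epsilon> F + ?\<epsilon> F \<in> ideal_power P (Suc n)"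
    by (rule ideal_add[OF is_ideal_power])
  then have "(t' * t) * f \<in> ideal_power P (Suc n)"
    by (simp add: mult.assoc del: ideal_power.simps)
  moreover have "t' * t \<notin> P"
    using t(1) t' prime_mult_iff[OF P] by blast
  ultimately show ?case
    by blast
qed

section \<open>The Zariski--Nagata theorem\<close>

text \<open>If \<open>J\<close> contains \<open>P\<close> locally at \<open>P\<close>, the same
  holds for their powers: factors use their own multipliers, sums a common one.\<close>

lemma ideal_power_multiplier:
  assumes P: "prime_ideal P" and "\<And>p. p \<in> P \<Longrightarrow> \<exists>s. s \<notin> P \<and> s * p \<in> J"
  shows "f \<in> ideal_power P n \<Longrightarrow> \<exists>s. s \<notin> P \<and> s * f \<in> ideal_power J n"
proof (induction n arbitrary: f)
  case 0
  then show ?case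
    using prime_one[OF P] by auto
next
  case (Suc n)
  note idJ = is_ideal_power[of J "Suc n"]
  from Suc.prems show ?case
  proof (induction rule: ideal_power_Suc_induct)
    case zero
    show ?case
      using prime_one[OF P] ideal_zero[OF idJ] by (metis mult_zero_right)
  next
    case (step a b y)
    obtain s1 s2 s3 where s: "s1 \<notin> P" "s2 \<notin> P" "s3 \<notin> P"
      and m: "s1 * a \<in> J" "s2 * b \<in> ideal_power J n" "s3 * y \<in> ideal_power J (Suc n)"
      using assms(2)[OF step(1)] Suc.IH[OF step(2)] step(3) by blast
    have "s3 * ((s1 * a) * (s2 * b)) + (s1 * s2) * (s3 * y) \<in> ideal_power J (Suc n)"
      by (intro ideal_add[OF idJ] ideal_mult[OF idJ] ideal_power_SucI m)
    also have "s3 * ((s1 * a) * (s2 * b)) + (s1 * s2) * (s3 * y) = (s1 * s2 * s3) * (a * b + y)"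
      by (simp add: algebra_simps)
    finally show ?case
      using s prime_mult_iff[OF P] by blast
  qed
qed

text \<open>The second half of Zariski--Nagata. At a minimal prime \<open>P\<close> the Hasse
  derivatives of order below \<open>n\<close> lie in \<open>P\<close>, so \<open>f\<close> is
  locally in the power of \<open>P\<close>, which is then exchanged for that of
  \<open>J\<close>.\<close>

lemma differential_power_subset_symbolic_power:
  fixes J :: "('v::{finite,linorder}, 'k::field) mpoly set"
  assumes perfect: "perfect_field TYPE('k)" and J: "radical_ideal J"
  shows "differential_power mscale J n \<subseteq> symbolic_power J n"
proof
  fix f assume f: "f \<in> differential_power mscale J n"
  have "\<exists>s. s \<notin> P \<and> s * f \<in> ideal_power J n" if P: "P \<in> minimal_primes J" for P
  proof -
    have pr: "prime_ideal P" and "J \<subseteq> P"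
      using P by (auto simp: minimal_primes_def)
    obtain I u s where dual: "dual_coordinates P I u s"
      and gen: "\<forall>a\<in>P. \<exists>t c. t \<notin> P \<and> t * a - (\<Sum>i\<in>I. c i * u i) \<in> ideal_power P 2"
      using transversal_coordinates[OF perfect pr] by blast
    have "taylor f \<in> low_coeffs_in P I n"
      using differential_power_taylor[OF f, of I] \<open>J \<subseteq> P\<close> by (auto simp: low_coeffs_in_def)
    then obtain t where t: "t \<notin> P" "t * f \<in> ideal_power P n"
      using mem_ideal_power_of_taylor[OF pr dual] gen by blast
    obtain s' where "s' \<notin> P" "s' * (t * f) \<in> ideal_power J n"
      using ideal_power_multiplier[OF pr minimal_prime_radical_multiplier[OF J P] t(2)] by blast
    then have "s' * t \<notin> P" "(s' * t) * f \<in> ideal_power J n"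
      using t(1) prime_mult_iff[OF pr] by (simp_all add: mult.assoc)
    then show ?thesis
      by blast
  qed
  then show "f \<in> symbolic_power J n"
    by (simp add: mem_symbolic_power_iff)
qed

theorem proposition10p6:
  fixes J :: "('n::{finite,linorder}, 'k::field) mpoly set"
    and n :: nat
  assumes "is_ideal J" and "n \<ge> 1"
  shows "incl_S ` differential_power mscale J n
           = ideal_sum (tilde J) (ideal_power Delta n) \<inter> range incl_S
       \<and> (perfect_field TYPE('k) \<and> radical_ideal J \<longrightarrow>
           incl_S ` symbolic_power J n
             = ideal_sum (tilde J) (ideal_power Delta n) \<inter> range incl_S)"
proof (intro conjI impI)
  show diagonal: "incl_S ` differential_power mscale J n
      = ideal_sum (tilde J) (ideal_power Delta n) \<inter> range incl_S"
    by (rule differential_power_eq_diagonal[OF assms])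
  assume "perfect_field TYPE('k) \<and> radical_ideal J"
  then have "symbolic_power J n = differential_power mscale J n"
    using differential_power_subset_symbolic_power symbolic_power_subset_differential_power
      assms(2) by blast
  with diagonal show "incl_S ` symbolic_power J n
      = ideal_sum (tilde J) (ideal_power Delta n) \<inter> range incl_S"
    by simp
qed

end
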